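(* Let $V=V(4,3)$ and let $(M,G,V,\mathcal{E})$ be a homogeneous factorisation of $K_{81}=(V,E)$ of index $5$, in which $M$ is arc-transitive on each factor and each factor is isomorphic to the Hamming graph $H(9,2)$, where $G=T\rtimes G_0\le AGL(4,3)$ is $2$-transitive on $V$, $G_0$ has a normal extraspecial subgroup $\mathbf{E}$ of order $2^5$ with $G_0/\mathbf{E}$ isomorphic to a subgroup of $S_5$, and $M=T\rtimes\mathbf{E}$. Then the maximal cliques (copies of $K_9$) of the five factors give an edge partition of $K_{81}$ into $90$ copies of $K_9$. Letting $\mathcal{B}$ be the set of vertex sets of these $90$ cliques, $\mathcal{D}=(V,\mathcal{B})$ is a $2$-$(81,9,1)$ design; furthermore $G\le\mathrm{Aut}(\mathcal{D})$ is $2$-transitive on the points of $\mathcal{D}$, and $\mathcal{D}$ is an affine plane isomorphic to the exceptional nearfield plane of order $9$.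
   Context: A homogeneous factorisation of index $k>1$ of $K_n=(V,E)$ is a 4-tuple $(M,G,V,\mathcal{E})$ where $\mathcal{E}$ partitions the 2-subsets of $V$ into $k$ parts, $G\le\mathrm{Sym}(V)$ is transitive on $V$, leaves $\mathcal{E}$ invariant and permutes its parts transitively, and the kernel $M$ of this action is transitive on $V$; factors are $(V,E_i)$. $T$ is the translation group of $V$. A $2$-$(v,\kappa,1)$ design is a set of $v$ points with a collection of $\kappa$-subsets (blocks) such that every 2-subset of points lies in exactly one block; its automorphisms are point permutations preserving the block set. $H(9,2)$ has vertices the pairs from a 9-set, adjacent iff they differ in exactly one coordinate. *)

theory Defs
  imports
    "HOL-Analysis.Cartesian_Space"
    "HOL-Algebra.Bij"
    "HOL-Algebra.Coset"
    "HOL-Algebra.Group_Action"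
    "HOL-Algebra.Sym_Groups"
    "HOL-Library.Disjoint_Sets"
    "HOL-Library.Ramsey"
    "HOL-Computational_Algebra.Primes"
begin

section \<open>Permutation groups\<close>

abbreviation perm_group :: "'a set \<Rightarrow> ('a \<Rightarrow> 'a) set \<Rightarrow> ('a \<Rightarrow> 'a) monoid"
  where "perm_group V G \<equiv> (BijGroup V)\<lparr>carrier := G\<rparr>"

definition transitive_on :: "('a \<Rightarrow> 'a) set \<Rightarrow> 'a set \<Rightarrow> bool"
  where "transitive_on G V \<longleftrightarrow> (\<forall>x\<in>V. \<forall>y\<in>V. \<exists>g\<in>G. g x = y)"

definition two_transitive_on :: "('a \<Rightarrow> 'a) set \<Rightarrow> 'a set \<Rightarrow> bool"
  where "two_transitive_on G V \<longleftrightarrow>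
    (\<forall>x\<in>V. \<forall>y\<in>V. \<forall>x'\<in>V. \<forall>y'\<in>V. x \<noteq> y \<longrightarrow> x' \<noteq> y' \<longrightarrow> (\<exists>g\<in>G. g x = x' \<and> g y = y'))"

definition internal_semidirect_product ::
    "('a, 'b) monoid_scheme \<Rightarrow> 'a set \<Rightarrow> 'a set \<Rightarrow> bool"
  where "internal_semidirect_product H N K \<longleftrightarrow>
    N \<lhd> H \<and> subgroup K H \<and> N \<inter> K = {\<one>\<^bsub>H\<^esub>} \<and> N <#>\<^bsub>H\<^esub> K = carrier H"

definition group_centre :: "('a, 'b) monoid_scheme \<Rightarrow> 'a set"
  where "group_centre H = {z \<in> carrier H. \<forall>x\<in>carrier H. z \<otimes>\<^bsub>H\<^esub> x = x \<otimes>\<^bsub>H\<^esub> z}"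

definition elementary_abelian :: "nat \<Rightarrow> ('a, 'b) monoid_scheme \<Rightarrow> bool"
  where "elementary_abelian p H \<longleftrightarrow>
    comm_group H \<and> finite (carrier H) \<and> (\<forall>x\<in>carrier H. x [^]\<^bsub>H\<^esub> p = \<one>\<^bsub>H\<^esub>)"

definition extraspecial :: "nat \<Rightarrow> ('a, 'b) monoid_scheme \<Rightarrow> bool"
  where "extraspecial p H \<longleftrightarrow>
    Factorial_Ring.prime p \<and> group H \<and> (\<exists>n. order H = p ^ n) \<and>
    card (group_centre H) = p \<and>
    group_centre H \<noteq> carrier H \<and>
    elementary_abelian p (H Mod group_centre H)"

section \<open>Graphs and homogeneous factorisations\<close>

text \<open>A graph is given by its vertex set and its edge set, a set of 2-subsets of the vertex set;
  the edge set of the complete graph on \<open>V\<close> is \<open>nsets V 2\<close>.\<close>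

definition graph_isomorphic :: "'a set \<Rightarrow> 'a set set \<Rightarrow> 'b set \<Rightarrow> 'b set set \<Rightarrow> bool"
  where "graph_isomorphic V E W F \<longleftrightarrow>
    (\<exists>f. bij_betw f V W \<and> (\<forall>x\<in>V. \<forall>y\<in>V. {x, y} \<in> E \<longleftrightarrow> {f x, f y} \<in> F))"

definition arc_transitive_on :: "('a \<Rightarrow> 'a) set \<Rightarrow> 'a set \<Rightarrow> 'a set set \<Rightarrow> bool"
  where "arc_transitive_on G V E \<longleftrightarrow>
    (\<forall>g\<in>G. image g ` E = E) \<and>
    (\<forall>x\<in>V. \<forall>y\<in>V. \<forall>x'\<in>V. \<forall>y'\<in>V.
       {x, y} \<in> E \<longrightarrow> {x', y'} \<in> E \<longrightarrow> (\<exists>g\<in>G. g x = x' \<and> g y = y'))"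

definition maximal_cliques :: "'a set \<Rightarrow> 'a set set \<Rightarrow> 'a set set"
  where "maximal_cliques V E =
    {C. C \<subseteq> V \<and> clique C E \<and> (\<forall>C'. C \<subseteq> C' \<longrightarrow> C' \<subseteq> V \<longrightarrow> clique C' E \<longrightarrow> C' = C)}"

text \<open>The Hamming graph \<open>H(q,2)\<close>.\<close>

definition hamming2_verts :: "nat \<Rightarrow> (nat \<times> nat) set"
  where "hamming2_verts q = {..<q} \<times> {..<q}"

definition hamming2_edges :: "nat \<Rightarrow> (nat \<times> nat) set set"
  where "hamming2_edges q =
    {{u, v} | u v. u \<in> hamming2_verts q \<and> v \<in> hamming2_verts q \<and>
                   (fst u \<noteq> fst v \<and> snd u = snd v \<or> fst u = fst v \<and> snd u \<noteq> snd v)}"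

definition homogeneous_factorisation ::
    "nat \<Rightarrow> ('a \<Rightarrow> 'a) set \<Rightarrow> ('a \<Rightarrow> 'a) set \<Rightarrow> 'a set \<Rightarrow> 'a set set set \<Rightarrow> bool"
  where "homogeneous_factorisation k M G V \<E> \<longleftrightarrow>
    k > 1 \<and> finite V \<and>
    partition_on (nsets V 2) \<E> \<and> card \<E> = k \<and>
    subgroup G (BijGroup V) \<and> transitive_on G V \<and>
    (\<forall>g\<in>G. \<forall>P\<in>\<E>. image g ` P \<in> \<E>) \<and>
    (\<forall>P\<in>\<E>. \<forall>Q\<in>\<E>. \<exists>g\<in>G. image g ` P = Q) \<and>
    M = {g\<in>G. \<forall>P\<in>\<E>. image g ` P = P} \<and>
    transitive_on M V"

section \<open>Affine groups\<close>

definition translation_group :: "('a::ab_group_add \<Rightarrow> 'a) set"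
  where "translation_group = range (\<lambda>b x. x + b)"

definition affine_linear_maps :: "('f::field ^ 'n \<Rightarrow> 'f ^ 'n) set"
  where "affine_linear_maps = {\<lambda>x. A *v x + b | A b. invertible A}"

definition AGL :: "('f::field ^ 'n \<Rightarrow> 'f ^ 'n) monoid"
  where "AGL = perm_group UNIV affine_linear_maps"

section \<open>Designs and affine planes\<close>

definition two_design :: "nat \<Rightarrow> nat \<Rightarrow> 'a set \<Rightarrow> 'a set set \<Rightarrow> bool"
  where "two_design v \<kappa> V \<B> \<longleftrightarrow>
    finite V \<and> card V = v \<and> \<B> \<subseteq> nsets V \<kappa> \<and> (\<forall>e \<in> nsets V 2. \<exists>!B. B \<in> \<B> \<and> e \<subseteq> B)"

definition design_Aut :: "'a set \<Rightarrow> 'a set set \<Rightarrow> ('a \<Rightarrow> 'a) monoid"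
  where "design_Aut V \<B> = perm_group V {g \<in> Bij V. image g ` \<B> = \<B>}"

definition design_isomorphic :: "'a set \<Rightarrow> 'a set set \<Rightarrow> 'b set \<Rightarrow> 'b set set \<Rightarrow> bool"
  where "design_isomorphic V \<B> W \<C> \<longleftrightarrow> (\<exists>f. bij_betw f V W \<and> image f ` \<B> = \<C>)"

definition affine_plane :: "'a set \<Rightarrow> 'a set set \<Rightarrow> bool"
  where "affine_plane V \<L> \<longleftrightarrow>
    \<L> \<subseteq> Pow V \<and> (\<forall>L\<in>\<L>. \<exists>x\<in>L. \<exists>y\<in>L. x \<noteq> y) \<and>
    (\<forall>x\<in>V. \<forall>y\<in>V. x \<noteq> y \<longrightarrow> (\<exists>!L. L \<in> \<L> \<and> x \<in> L \<and> y \<in> L)) \<and>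
    (\<forall>L\<in>\<L>. \<forall>x\<in>V - L. \<exists>!L'. L' \<in> \<L> \<and> x \<in> L' \<and> L \<inter> L' = {}) \<and>
    (\<exists>x\<in>V. \<exists>y\<in>V. \<exists>z\<in>V. x \<noteq> y \<and> x \<noteq> z \<and> y \<noteq> z \<and> \<not> (\<exists>L\<in>\<L>. {x, y, z} \<subseteq> L))"

section \<open>The exceptional nearfield of order 9 and its plane\<close>

text \<open>Right nearfields: only \<open>(x + y) \<circ> m = x \<circ> m + y \<circ> m\<close> is required.\<close>

definition nearfield :: "('a::ab_group_add \<Rightarrow> 'a \<Rightarrow> 'a) \<Rightarrow> bool"
  where "nearfield m \<longleftrightarrow>
    (\<forall>x y z. m (x + y) z = m x z + m y z) \<and> (\<forall>x. m x 0 = 0) \<and>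
    (\<exists>e. group \<lparr>carrier = UNIV - {0}, monoid.mult = m, one = e\<rparr>)"

text \<open>The lines of the affine plane on pairs over a right nearfield.  The slope is the right-hand
  factor, so that each \<open>x \<mapsto> x \<circ> s\<close> is additive and the plane is a translation plane.\<close>

definition nearfield_plane_lines :: "('a::ab_group_add \<Rightarrow> 'a \<Rightarrow> 'a) \<Rightarrow> ('a \<times> 'a) set set"
  where "nearfield_plane_lines m =
    range (\<lambda>(s, b). {(x, y). y = m x s + b}) \<union> range (\<lambda>c. {(x, y). x = c})"

text \<open>For a field of three elements, the pair \<open>(a, b)\<close> stands for \<open>a + b i\<close> in
  \<open>GF(9) = GF(3)[i]\<close>, where \<open>i * i = -1\<close>.\<close>

definition gf9_mult :: "'f::field \<times> 'f \<Rightarrow> 'f \<times> 'f \<Rightarrow> 'f \<times> 'f"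
  where "gf9_mult x y = (fst x * fst y - snd x * snd y, fst x * snd y + snd x * fst y)"

text \<open>Dickson's twisted multiplication, giving the unique nearfield of order 9 that is not a
  field: \<open>x \<circ> y\<close> is \<open>x y\<close> if \<open>y\<close> is a square in \<open>GF(9)\<close>, and \<open>x\<^sup>3 y\<close> otherwise.\<close>

definition nearfield9_mult :: "'f::field \<times> 'f \<Rightarrow> 'f \<times> 'f \<Rightarrow> 'f \<times> 'f"
  where "nearfield9_mult x y =
    (if \<exists>z. y = gf9_mult z z then gf9_mult x y else gf9_mult (gf9_mult x (gf9_mult x x)) y)"

lemma field3_cases:
  fixes a :: "'f::field"
  assumes "CARD('f) = 3"
  shows "a = 0 \<or> a = 1 \<or> a = -1" and "(1::'f) + 1 = -1" and "(1::'f) \<noteq> -1"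
proof -
  have fin: "finite (UNIV::'f set)" using assms by (intro card_ge_0_finite) simp
  have ne: "(1::'f) \<noteq> -1"
  proof
    assume h: "(1::'f) = -1"
    then have two: "x + x = 0" for x :: 'f
      by (metis add.right_inverse mult_1 mult_minus1)
    obtain c :: 'f where c: "c \<noteq> 0" "c \<noteq> 1"
    proof -
      have "\<not> (UNIV::'f set) \<subseteq> {0, 1}"
        using assms card_mono[of "{0,1::'f}" UNIV] by auto
      then show ?thesis using that by auto
    qed
    have "c + 1 \<noteq> 0"
      using c(2) two[of 1] by (metis add_right_cancel)
    then have "card {0, 1, c, c + 1} = 4" using c by auto
    then show False using assms card_mono[OF fin, of "{0, 1, c, c + 1}"] by simp
  qed
  then have "card {0, 1, -1::'f} = CARD('f)" using assms by simp
  then have U: "{0, 1, -1::'f} = UNIV" using fin by (metis card_subset_eq subset_UNIV)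
  show "a = 0 \<or> a = 1 \<or> a = -1" using U by blast
  show "(1::'f) \<noteq> -1" by fact
  have "(1::'f) + 1 \<noteq> 1" by (metis add_cancel_right_right zero_neq_one)
  moreover have "(1::'f) + 1 \<noteq> 0" using ne by (metis add.inverse_unique)
  ultimately show "(1::'f) + 1 = -1" using U by blast
qed

lemma gf9_square_iff:
  fixes y :: "'f::field \<times> 'f"
  assumes "CARD('f) = 3"
  shows "(\<exists>z. y = gf9_mult z z) \<longleftrightarrow> fst y = 0 \<or> snd y = 0"
proof -
  note F = field3_cases[where 'f = 'f, OF assms]
  have m: "(-1::'f) - 1 = 1" "(-1::'f) + -1 = 1"
    using F(2) by (metis add.inverse_inverse minus_add_distrib diff_conv_add_uminus)+
  show ?thesis
  proof
    assume "\<exists>z. y = gf9_mult z z"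
    then obtain a b where "y = gf9_mult (a, b) (a, b)" by auto
    then show "fst y = 0 \<or> snd y = 0"
      using F(1)[of a] F(1)[of b] by (auto simp: gf9_mult_def)
  next
    assume h: "fst y = 0 \<or> snd y = 0"
    have "y = gf9_mult (0,0) (0,0) \<or> y = gf9_mult (1,0) (1,0) \<or> y = gf9_mult (0,1) (0,1)
       \<or> y = gf9_mult (1,1) (1,1) \<or> y = gf9_mult (1,-1) (1,-1)"
      using h F(1)[of "fst y"] F(1)[of "snd y"] F(2) F(3) m
      by (cases y) (auto simp: gf9_mult_def)
    then show "\<exists>z. y = gf9_mult z z" by blast
  qed
qed

lemma gf9_assoc: "gf9_mult (gf9_mult x y) z = gf9_mult x (gf9_mult y z)"
  by (simp add: gf9_mult_def algebra_simps)

lemma gf9_cube: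
  fixes x :: "'f::field \<times> 'f"
  assumes "CARD('f) = 3"
  shows "gf9_mult x (gf9_mult x x) = (fst x, - snd x)"
proof -
  note F = field3_cases[where 'f = 'f, OF assms]
  have m: "(-1::'f) - 1 = 1" "(-1::'f) + -1 = 1"
    using F(2) by (metis add.inverse_inverse minus_add_distrib diff_conv_add_uminus)+
  show ?thesis
    using F(1)[of "fst x"] F(1)[of "snd x"] F(2) F(3) m
    by (cases x) (auto simp: gf9_mult_def)
qed

lemma nearfield9_mult_eq:
  fixes x y :: "'f::field \<times> 'f"
  assumes "CARD('f) = 3"
  shows "nearfield9_mult x y =
    (if fst y = 0 \<or> snd y = 0 then gf9_mult x y else gf9_mult (fst x, - snd x) y)"
  unfolding nearfield9_mult_def gf9_square_iff[OF assms] gf9_cube[OF assms] ..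

lemma nearfield9_nearfield:
  assumes "CARD('f::field) = 3"
  shows "nearfield (nearfield9_mult :: 'f \<times> 'f \<Rightarrow> _)"
    and "nearfield9_mult (0, 1) (1, 1) \<noteq> nearfield9_mult (1, 1) (0, 1 :: 'f)"
proof -
  note F = field3_cases[where 'f = 'f, OF assms]
  note eq = nearfield9_mult_eq[OF assms]
  have m: "(-1::'f) - 1 = 1" "(-1::'f) + -1 = 1" "(-1::'f) \<noteq> 1"
    using F(2,3) by (metis add.inverse_inverse minus_add_distrib diff_conv_add_uminus)+
  have n: "(2::'f) = -1" "(3::'f) = 0"
    using F(2) by (simp, metis F(2) add.right_inverse add.commute one_add_one numeral_plus_one
        add_One semiring_norm(5))
  have A: "nearfield9_mult (nearfield9_mult x y) z = nearfield9_mult x (nearfield9_mult y z)"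
    for x y z :: "'f \<times> 'f"
  proof -
    obtain a b c d where yz: "y = (a, b)" "z = (c, d)" by (metis surj_pair)
    show ?thesis
      using F(1)[of a] F(1)[of b] F(1)[of c] F(1)[of d] unfolding yz
      by (elim disjE; simp add: eq gf9_mult_def m n F(2,3) algebra_simps)
  qed
  have I: "\<exists>y. y \<noteq> 0 \<and> nearfield9_mult y x = (1, 0)" if "x \<noteq> 0" for x :: "'f \<times> 'f"
  proof -
    obtain a b where x: "x = (a, b)" by (metis surj_pair)
    let ?S = "{(1,0), (-1,0), (0,1), (0,-1), (1,1), (1,-1), (-1,1), (-1,-1)} :: ('f \<times> 'f) set"
    have "\<exists>y\<in>?S. nearfield9_mult y x = (1, 0)"
      using F(1)[of a] F(1)[of b] that unfolding x
      by (elim disjE; simp add: eq gf9_mult_def m n F(2,3) zero_prod_def)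
    moreover have "0 \<notin> ?S" by (simp add: zero_prod_def)
    ultimately show ?thesis by metis
  qed
  have Z: "nearfield9_mult x y \<noteq> 0" if "x \<noteq> 0" "y \<noteq> 0" for x y :: "'f \<times> 'f"
  proof -
    obtain a b c d where yz: "x = (a, b)" "y = (c, d)" by (metis surj_pair)
    show ?thesis
      using F(1)[of a] F(1)[of b] F(1)[of c] F(1)[of d] that unfolding yz
      by (elim disjE; simp add: eq gf9_mult_def m n F(2,3) zero_prod_def)
  qed
  have "group \<lparr>carrier = UNIV - {0}, monoid.mult = nearfield9_mult, one = (1, 0::'f)\<rparr>"
    (is "group ?N")
  proof (rule groupI)
    show "\<exists>y\<in>carrier ?N. y \<otimes>\<^bsub>?N\<^esub> x = \<one>\<^bsub>?N\<^esub>" if "x \<in> carrier ?N" for x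
      using I[of x] that by (simp add: Bex_def del: split_paired_Ex)
    show "\<one>\<^bsub>?N\<^esub> \<otimes>\<^bsub>?N\<^esub> x = x" for x
      by (simp add: eq gf9_mult_def)
  qed (use A Z in \<open>simp_all add: zero_prod_def\<close>)
  then show "nearfield (nearfield9_mult :: 'f \<times> 'f \<Rightarrow> _)"
    unfolding nearfield_def
    by (auto simp: eq gf9_mult_def algebra_simps zero_prod_def)
  show "nearfield9_mult (0, 1) (1, 1) \<noteq> nearfield9_mult (1, 1) (0, 1 :: 'f)"
    using m n F by (simp add: eq gf9_mult_def)
qed

end

theory Submission
  imports Defs
begin

text \<open>
  Every nonzero vector has a \<open>Q\<close>-orbit of size 16, hence is fixed by exactly one nonidentity element of
  \<open>Q\<close>, an involution. This forces the centre of \<open>Q\<close> to be \<open>{1, -1}\<close> and any two noncentral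
  involutions \<open>s \<noteq> \<plusminus>t\<close> to anticommute, so the fixed spaces of the noncentral involutions are
  subspaces of size 9 that form a spread, and the orbit of a vector fixed by \<open>t\<close> consists of the nonzero
  vectors fixed by \<open>t\<close> or \<open>-t\<close>. Each factor is therefore a Cayley graph whose maximal cliques are the
  cosets of two complementary spread components, and the design is the translation plane of the
  spread. Pairwise anticommuting involutions determine the spread up to a linear map, which gives
  coordinates identifying it with the spread of the nearfield plane.
\<close>

section \<open>Characteristic three, and maximal cliques of Cayley graphs\<close>

lemma field3_vec_double:
  fixes x :: "'f::field ^ 'n"
  assumes "CARD('f) = 3"
  shows "x + x = - x"
proof -
  have "x $ i + x $ i = - x $ i" for i
    using field3_cases(1)[OF assms, of "x $ i"] field3_cases(2)[where 'f='f, OF assms]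
    by (metis add.inverse_inverse add.inverse_neutral add_0 minus_add_distrib)
  then show ?thesis by (simp add: vec_eq_iff)
qed

text \<open>If a clique contains \<open>x\<close>, some \<open>y\<close> with \<open>y - x\<close>
  outside \<open>W\<close> and some \<open>y'\<close> with \<open>y' - x\<close> outside
  \<open>W'\<close>, then \<open>y - x\<close> lies in \<open>W'\<close> and \<open>y' - x\<close>
  in \<open>W\<close>. The adjacent pair \<open>y\<close>, \<open>y'\<close> differs by an element
  of \<open>W\<close> or of \<open>W'\<close>, and either case is contradictory. So every clique
  through \<open>x\<close> lies in one of the two cosets through \<open>x\<close>, and neither coset
  contains the other.\<close>

lemma maximal_cliques_two_subgroups:
  fixes W W' :: "'v::ab_group_add set"
  assumes diff: "\<And>x y. x \<in> W \<Longrightarrow> y \<in> W \<Longrightarrow> x - y \<in> W" "\<And>x y. x \<in> W' \<Longrightarrow> y \<in> W' \<Longrightarrow> x - y \<in> W'"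
    and inter: "W \<inter> W' = {0}" and ne: "W \<noteq> {0}" "W' \<noteq> {0}"
    and adj: "\<And>x y. {x, y} \<in> P \<longleftrightarrow> x \<noteq> y \<and> y - x \<in> W \<union> W'"
  shows "maximal_cliques UNIV P = range (\<lambda>x. (+) x ` W) \<union> range (\<lambda>x. (+) x ` W')"
proof -
  have zero: "0 \<in> W" "0 \<in> W'" using inter by auto
  have neg': "- x \<in> W'" if "x \<in> W'" for x using diff(2)[OF zero(2) that] by simp
  have coset: "(y \<in> (+) x ` A) = (y - x \<in> A)" for x y :: 'v and A
    by (metis add_diff_cancel_left' diff_add_cancel add.commute image_iff)
  have cl: "clique ((+) x ` W) P" "clique ((+) x ` W') P" for x
    unfolding clique_def using diff by (auto simp: adj)
  have sub: "C \<subseteq> (+) x ` W \<or> C \<subseteq> (+) x ` W'" if C: "clique C P" "x \<in> C" for C x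
  proof (rule ccontr)
    assume "\<not> ?thesis"
    then obtain y y' where y: "y \<in> C" "y - x \<notin> W" "y' \<in> C" "y' - x \<notin> W'"
      by (auto simp: coset subset_iff)
    have in1: "y - x \<in> W'" using C y adj[of x y] zero unfolding clique_def by fastforce
    have in2: "y' - x \<in> W" using C y adj[of x y'] zero unfolding clique_def by fastforce
    have "y \<noteq> y'" using y in1 by auto
    then have "y' - y \<in> W \<union> W'" using C y adj[of y y'] unfolding clique_def by fastforce
    then show False
    proof
      assume "y' - y \<in> W"
      from diff(1)[OF in2 this] y(2) show False by simp
    next
      assume "y' - y \<in> W'"
      from diff(2)[OF this neg'[OF in1]] y(4) show False by simp
    qed
  qed
  have not_sub: "\<not> (+) x ` W \<subseteq> (+) x ` W'" "\<not> (+) x ` W' \<subseteq> (+) x ` W" for x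
    using inter ne zero by (auto simp: image_subset_iff coset)
  have self: "x \<in> (+) x ` W" "x \<in> (+) x ` W'" for x using zero by (auto simp: coset)
  show ?thesis
  proof (intro Set.set_eqI iffI)
    fix C assume "C \<in> maximal_cliques UNIV P"
    then have C: "clique C P" and max: "\<And>C'. C \<subseteq> C' \<Longrightarrow> clique C' P \<Longrightarrow> C' = C"
      by (auto simp: maximal_cliques_def)
    \<comment> \<open>A singleton is a clique, so the empty clique is not maximal.\<close>
    have "C \<noteq> {}"
      using max[of "{0}"] by (auto simp: clique_def)
    then obtain x where "x \<in> C" by auto
    from sub[OF C this] show "C \<in> range (\<lambda>x. (+) x ` W) \<union> range (\<lambda>x. (+) x ` W')"
      using max cl by blast
  next
    fix C assume "C \<in> range (\<lambda>x. (+) x ` W) \<union> range (\<lambda>x. (+) x ` W')"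
    then obtain x where x: "C = (+) x ` W \<or> C = (+) x ` W'" by auto
    have "C' = C" if C': "C \<subseteq> C'" "clique C' P" for C'
    proof -
      have "x \<in> C'" using x C' self by blast
      from sub[OF C'(2) this] show ?thesis
      proof
        assume "C' \<subseteq> (+) x ` W"
        then show ?thesis using x C'(1) not_sub(2)[of x] by (metis subset_trans subset_antisym)
      next
        assume "C' \<subseteq> (+) x ` W'"
        then show ?thesis using x C'(1) not_sub(1)[of x] by (metis subset_trans subset_antisym)
      qed
    qed
    then show "C \<in> maximal_cliques UNIV P"
      using x cl unfolding maximal_cliques_def by auto
  qed
qed

text \<open>The interface between the group theory and the geometry: \<open>commutator\<close> says
  that commutators lie in \<open>{id, z}\<close>, while \<open>stabiliser\<close> and
  \<open>orbit\<close> say that every nonzero vector has a stabiliser of order 2 and an orbit of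
  length 16.\<close>

locale extraspecial_spread =
  fixes Q :: "('f::{field,finite} ^ 4 \<Rightarrow> 'f ^ 4) set" and z
  assumes card3: "CARD('f) = 3"
    and add: "q \<in> Q \<Longrightarrow> q (x + y) = q x + q y"
    and scale: "q \<in> Q \<Longrightarrow> q (c *s x) = c *s q x"
    and inj: "q \<in> Q \<Longrightarrow> inj q"
    and comp: "q \<in> Q \<Longrightarrow> r \<in> Q \<Longrightarrow> (\<lambda>x. q (r x)) \<in> Q"
    and z: "z \<in> Q" "z \<noteq> id" "z (z x) = x"
    and central: "q \<in> Q \<Longrightarrow> q (z x) = z (q x)"
    and commutator: "q \<in> Q \<Longrightarrow> r \<in> Q \<Longrightarrow> (\<forall>x. q (r x) = r (q x)) \<or> (\<forall>x. q (r x) = z (r (q x)))"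
    and stabiliser: "v \<noteq> 0 \<Longrightarrow> \<exists>!t. t \<in> Q \<and> t \<noteq> id \<and> t v = v"
    and orbit: "v \<noteq> 0 \<Longrightarrow> card ((\<lambda>q. q v) ` Q) = 16"
begin

section \<open>The central involution, the other involutions and their fixed spaces\<close>

lemmas double = field3_vec_double[OF card3]

lemma zero: "q \<in> Q \<Longrightarrow> q 0 = 0"
  using add[of q 0 0] by simp

lemma minus: "q \<in> Q \<Longrightarrow> q (- x) = - q x"
  using add[of q x "- x"] zero by (metis add.right_inverse add_eq_0_iff)

lemma diff: "q \<in> Q \<Longrightarrow> q (x - y) = q x - q y"
  using add[of q x "- y"] minus by simp

lemma self_eq_minus: "x = - x \<longleftrightarrow> (x :: 'f ^ 4) = 0"
  using double[of x] by (metis add_eq_0_iff minus_zero neg_0_equal_iff_equal add.inverse_inverse)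

lemma stabiliser_unique:
  assumes "v \<noteq> 0" "s \<in> Q" "t \<in> Q" "s \<noteq> id" "t \<noteq> id" "s v = v" "t v = v"
  shows "s = t"
  using stabiliser[OF assms(1)] assms by blast

text \<open>If \<open>z\<close> had both eigenvalues, with eigenvectors \<open>v\<close> and \<open>w\<close>, the stabiliser of \<open>v + w\<close>
  would fix \<open>v\<close> and hence be generated by \<open>z\<close>, which moves \<open>w\<close>.\<close>

lemma z_eq: "z x = - x"
proof -
  have "v = 0" if v: "z v = v" for v
  proof (rule ccontr)
    assume v0: "v \<noteq> 0"
    obtain y where y: "z y \<noteq> y" using z(2) by fastforce
    \<comment> \<open>Up to sign, \<open>w\<close> is the component of \<open>y\<close> in the
      eigenspace of \<open>z\<close> for -1.\<close>
    define w where "w = y - z y"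
    have w: "z w = - w" "w \<noteq> 0" using y by (auto simp: w_def diff z)
    have "v + w \<noteq> 0"
    proof
      assume "v + w = 0"
      then have "w = - v" by (simp add: eq_neg_iff_add_eq_0 add.commute)
      with w v v0 show False using minus[OF z(1), of v] self_eq_minus[of v] by simp
    qed
    then obtain t where t: "t \<in> Q" "t \<noteq> id" "t (v + w) = v + w"
      using stabiliser by blast
    \<comment> \<open>As \<open>t\<close> fixes \<open>v + w\<close>, the vector \<open>d\<close> is
      both \<open>t v - v\<close>, which \<open>z\<close> fixes, and \<open>w - t w\<close>, which
      \<open>z\<close> negates; hence \<open>d = 0\<close>.\<close>
    define d where "d = t v - v"
    have d: "d = w - t w" using t add by (auto simp: d_def algebra_simps)
    have "z d = d" unfolding d_def using central[OF t(1), of v] v by (simp add: diff z)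
    moreover have "z d = - d"
      unfolding d using central[OF t(1), of w] w minus[OF t(1), of w]
      by (simp add: diff[OF z(1)]) (metis add.inverse_inverse)
    ultimately have "d = 0" using self_eq_minus by metis
    then have "t v = v" by (simp add: d_def)
    then have "t = z" using stabiliser_unique[OF v0 t(1) z(1) t(2) z(2)] v by blast
    then have "w = - w" using w d \<open>d = 0\<close> by simp
    then show False using w self_eq_minus by blast
  qed
  \<comment> \<open>\<open>z\<close> fixes \<open>x + z x\<close>, which therefore vanishes.\<close>
  from this[of "x + z x"] show ?thesis by (simp add: add z add.commute eq_neg_iff_add_eq_0)
qed

lemma neg_in: "q \<in> Q \<Longrightarrow> (\<lambda>x. - q x) \<in> Q"
  using comp[OF z(1), of q] by (simp add: z_eq)

lemma commutes: "q \<in> Q \<Longrightarrow> r \<in> Q \<Longrightarrow> (\<forall>x. q (r x) = r (q x)) \<or> (\<forall>x. q (r x) = - r (q x))"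
  using commutator[of q r] by (simp add: z_eq)

text \<open>These are the involutions of \<open>Q\<close> other than -1: a nonzero fixed vector
  excludes -1, and \<open>invs_sq\<close> shows that the order is 2.\<close>

definition invs :: "('f ^ 4 \<Rightarrow> 'f ^ 4) set"
  where "invs = {t \<in> Q. t \<noteq> id \<and> (\<exists>v. v \<noteq> 0 \<and> t v = v)}"

definition fixed :: "('f ^ 4 \<Rightarrow> 'f ^ 4) \<Rightarrow> ('f ^ 4) set"
  where "fixed t = {x. t x = x}"

lemma invs_in: "t \<in> invs \<Longrightarrow> t \<in> Q"
  by (simp add: invs_def)

text \<open>The square of \<open>t\<close> also fixes \<open>v\<close>, so it is \<open>id\<close>
  or \<open>t\<close>; the latter forces \<open>t = id\<close> by injectivity.\<close>

lemma invs_sq [simp]: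
  assumes "t \<in> invs"
  shows "t (t x) = x"
proof -
  obtain v where v: "t \<in> Q" "t \<noteq> id" "v \<noteq> 0" "t v = v" using assms by (auto simp: invs_def)
  have "(\<lambda>x. t (t x)) = id"
  proof (rule ccontr)
    assume "(\<lambda>x. t (t x)) \<noteq> id"
    then have "(\<lambda>x. t (t x)) = t"
      using stabiliser_unique[OF v(3) comp[OF v(1,1)] v(1)] v by auto
    then have "t (t y) = t y" for y by metis
    then have "t y = y" for y using injD[OF inj[OF v(1)]] by blast
    then show False using v(2) by auto
  qed
  then show ?thesis by (metis id_apply)
qed

lemma fixed_unique:
  assumes "s \<in> invs" "t \<in> invs" "v \<noteq> 0" "v \<in> fixed s" "v \<in> fixed t"
  shows "s = t"
  by (rule stabiliser_unique[OF assms(3)]) (use assms in \<open>auto simp: invs_def fixed_def\<close>)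

text \<open>With \<open>fixed_unique\<close> this makes the fixed spaces partition the nonzero
  vectors, which is the spread property.\<close>

lemma fixed_exists:
  assumes "v \<noteq> 0"
  obtains t where "t \<in> invs" "v \<in> fixed t"
proof -
  obtain t where "t \<in> Q" "t \<noteq> id" "t v = v" using stabiliser[OF assms] by blast
  then show thesis using that[of t] assms unfolding invs_def fixed_def by blast
qed

lemma fixed_inter: "s \<in> invs \<Longrightarrow> t \<in> invs \<Longrightarrow> s \<noteq> t \<Longrightarrow> fixed s \<inter> fixed t = {0}"
proof -
  assume "s \<in> invs" "t \<in> invs" "s \<noteq> t"
  then have "v = 0" if "v \<in> fixed s" "v \<in> fixed t" for v using fixed_unique that by blast
  moreover have "0 \<in> fixed s" "0 \<in> fixed t"
    using zero[OF invs_in] \<open>s \<in> invs\<close> \<open>t \<in> invs\<close> unfolding fixed_def by blast+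
  ultimately show ?thesis by blast
qed

lemma fixed_closed:
  assumes "t \<in> invs"
  shows "0 \<in> fixed t" "x \<in> fixed t \<Longrightarrow> y \<in> fixed t \<Longrightarrow> x + y \<in> fixed t"
    "x \<in> fixed t \<Longrightarrow> y \<in> fixed t \<Longrightarrow> x - y \<in> fixed t" "x \<in> fixed t \<Longrightarrow> - x \<in> fixed t"
    "x \<in> fixed t \<Longrightarrow> c *s x \<in> fixed t"
  using invs_in[OF assms] by (simp_all add: fixed_def zero add diff minus scale)

lemma neg_fixed: "x \<in> fixed (\<lambda>x. - t x) \<longleftrightarrow> t x = - x"
  unfolding fixed_def mem_Collect_eq by (metis add.inverse_inverse)

lemma invs_neg:
  assumes "t \<in> invs"
  shows "(\<lambda>x. - t x) \<in> invs"
proof -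
  \<comment> \<open>\<open>t\<close> moves some \<open>y\<close>, and then \<open>y - t y\<close> is
    a nonzero vector fixed by \<open>-t\<close>.\<close>
  obtain y where y: "t y \<noteq> y" using assms by (fastforce simp: invs_def)
  have "(\<lambda>x. - t x) \<noteq> id"
  proof
    assume "(\<lambda>x. - t x) = id"
    then have m: "- t x = x" for x by (metis id_apply)
    obtain v where v: "v \<noteq> 0" "t v = v" using assms by (auto simp: invs_def)
    then show False using m[of v] self_eq_minus[of v] by simp
  qed
  moreover have "- t (y - t y) = y - t y" using assms by (simp add: diff invs_in)
  ultimately show ?thesis
    using y neg_in[OF invs_in[OF assms]] unfolding invs_def
    by (metis (mono_tags, lifting) mem_Collect_eq right_minus_eq)
qed

lemma invs_neq_neg: "t \<in> invs \<Longrightarrow> t \<noteq> (\<lambda>x. - t x)"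
proof
  assume t: "t \<in> invs" "t = (\<lambda>x. - t x)"
  then obtain v where v: "v \<noteq> 0" "t v = v" by (auto simp: invs_def)
  then show False using fun_cong[OF t(2), of v] self_eq_minus[of v] by simp
qed

lemma fixed_nontrivial:
  assumes "t \<in> invs"
  obtains v where "v \<noteq> 0" "v \<in> fixed t"
  using assms by (auto simp: invs_def fixed_def)

text \<open>If \<open>s\<close> and \<open>t\<close> commuted, \<open>t\<close> would preserve
  \<open>fixed s\<close>. For \<open>v\<close> in \<open>fixed s\<close>, the vectors
  \<open>v + t v\<close> and \<open>v - t v\<close> would then lie in \<open>fixed s\<close> and
  also in the fixed space of \<open>t\<close> and of \<open>-t\<close> respectively, so both would
  be 0 and \<open>v = - v\<close>.\<close>

lemma anticommute:
  assumes "s \<in> invs" "t \<in> invs" "s \<noteq> t" "s \<noteq> (\<lambda>x. - t x)"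
  shows "s (t x) = - t (s x)"
proof (rule ccontr)
  assume "s (t x) \<noteq> - t (s x)"
  then have com: "s (t x) = t (s x)" for x
    using commutes[of s t] assms(1,2) invs_in by blast
  obtain v where v: "v \<noteq> 0" "v \<in> fixed s" using assms(1) fixed_nontrivial by blast
  have sv: "t v \<in> fixed s" using v com by (simp add: fixed_def)
  have "v + t v \<in> fixed s" "v - t v \<in> fixed s"
    using v sv fixed_closed[OF assms(1)] by auto
  moreover have "v + t v \<in> fixed t" "v - t v \<in> fixed (\<lambda>x. - t x)"
    using assms(2) by (auto simp: fixed_def add diff invs_in add.commute)
  ultimately have "v + t v = 0" "v - t v = 0"
    using fixed_inter[OF assms(1,2,3)] fixed_inter[OF assms(1) invs_neg[OF assms(2)] assms(4)]
    by blast+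
  then have "v = - v" by (metis eq_iff_diff_eq_0 eq_neg_iff_add_eq_0)
  then show False using v self_eq_minus by blast
qed

text \<open>The space is the direct sum of the eigenspaces of \<open>t\<close> for 1 and -1.\<close>

lemma card_fixed_prod:
  assumes "t \<in> invs"
  shows "card (fixed t) * card (fixed (\<lambda>x. - t x)) = 81"
proof -
  let ?n = "\<lambda>x. - t x"
  note n = invs_neg[OF assms]
  have int: "fixed t \<inter> fixed ?n = {0}" using fixed_inter[OF assms n] invs_neq_neg assms by blast
  have bij: "bij_betw (\<lambda>(x, y). x + y) (fixed t \<times> fixed ?n) UNIV"
    unfolding bij_betw_def
  proof (intro conjI inj_onI Set.set_eqI iffI UNIV_I)
    fix p q assume a: "p \<in> fixed t \<times> fixed ?n" "q \<in> fixed t \<times> fixed ?n"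
      "(case p of (x, y) \<Rightarrow> x + y) = (case q of (x, y) \<Rightarrow> x + y)"
    obtain x y x' y' where pq: "p = (x, y)" "q = (x', y')" by (metis surj_pair)
    have e: "x - x' = y' - y" using a(3) pq by (auto simp: algebra_simps)
    have "x - x' \<in> fixed t" using a pq fixed_closed(3)[OF assms] by blast
    moreover have "x - x' \<in> fixed ?n" unfolding e using a pq fixed_closed(3)[OF n] by blast
    ultimately have "x - x' = 0" using int by blast
    then show "p = q" using e pq by simp
  next
    fix x
    \<comment> \<open>Modulo 3 the inverse of 2 is -1, so these are the two eigenprojections of
      \<open>x\<close>.\<close>
    have "- (x + t x) \<in> fixed t" "- (x - t x) \<in> fixed ?n"
      using assms invs_in[OF assms] by (auto simp: fixed_def add diff minus add.commute)
    moreover have "x = - (x + t x) + - (x - t x)"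
      using double[of x] by (simp add: algebra_simps)
    ultimately show "x \<in> (\<lambda>(x, y). x + y) ` (fixed t \<times> fixed ?n)" by force
  qed
  have "CARD('f ^ 4) = 81" using card3 by simp
  then show "card (fixed t) * card (fixed ?n) = 81"
    using bij_betw_same_card[OF bij] by (simp add: card_cartesian_product)
qed

text \<open>A sum of nonzero eigenvectors for 1 and -1 lies in neither eigenspace of
  \<open>t\<close>, so the involution fixing it is new, even up to sign.\<close>

lemma second_involution:
  assumes "t \<in> invs"
  obtains s where "s \<in> invs" "s \<noteq> t" "s \<noteq> (\<lambda>x. - t x)"
proof -
  note n = invs_neg[OF assms]
  obtain v where v: "v \<noteq> 0" "v \<in> fixed t" using assms fixed_nontrivial by blast
  obtain w where w: "w \<noteq> 0" "w \<in> fixed (\<lambda>x. - t x)" using n fixed_nontrivial by blast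
  have tv: "t v = v" "t w = - w" using v w(2)[unfolded neg_fixed] by (auto simp: fixed_def)
  have tvw: "t (v + w) = v - w" using tv assms by (simp add: add invs_in)
  have "v + w \<noteq> v - w" using w self_eq_minus by auto
  moreover have "v - w \<noteq> - (v + w)" using v self_eq_minus by auto
  ultimately have nf: "v + w \<notin> fixed t" "v + w \<notin> fixed (\<lambda>x. - t x)"
    using tvw unfolding neg_fixed by (auto simp: fixed_def)
  then have "v + w \<noteq> 0" using fixed_closed(1)[OF assms] by auto
  then obtain s where "s \<in> invs" "v + w \<in> fixed s" using fixed_exists by blast
  then show thesis using that nf by blast
qed

text \<open>An anticommuting \<open>s\<close> interchanges the two eigenspaces of \<open>t\<close>,
  so they have equal size, with product 81.\<close>

lemma card_fixed:
  assumes "t \<in> invs"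
  shows "card (fixed t) = 9"
proof -
  let ?n = "\<lambda>x. - t x"
  obtain s where s: "s \<in> invs" "s \<noteq> t" "s \<noteq> ?n" using second_involution[OF assms] .
  have ac: "s (t x) = - t (s x)" for x using anticommute[OF s(1) assms s(2,3)] .
  have "t (s x) = - s x" if "t x = x" for x
    using ac[of x] that by (metis add.inverse_inverse)
  moreover have "t (s x) = s x" if "t x = - x" for x
    using ac[of x] that minus[OF invs_in[OF s(1)], of x] by simp
  ultimately have "s ` fixed t \<subseteq> fixed ?n" "s ` fixed ?n \<subseteq> fixed t"
    by (auto simp: neg_fixed, auto simp: fixed_def)
  then have "bij_betw s (fixed t) (fixed ?n)"
    using s(1) by (intro bij_betw_byWitness[where f'=s]) auto
  then have "card (fixed t) = card (fixed ?n)" by (rule bij_betw_same_card)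
  then have "card (fixed t) ^ 2 = 9 ^ 2" using card_fixed_prod[OF assms] by (simp add: power2_eq_square)
  then show ?thesis using power_eq_iff_eq_base[of 2 "card (fixed t)" 9] by simp
qed

text \<open>Addition is injective on the product of two fixed spaces that meet in 0, and 9 * 9 = 81
  makes it surjective.\<close>

lemma fixed_sum:
  assumes "s \<in> invs" "t \<in> invs" "s \<noteq> t"
  obtains x y where "x \<in> fixed s" "y \<in> fixed t" "v = x + y"
proof -
  have "inj_on (\<lambda>(x, y). x + y) (fixed s \<times> fixed t)"
  proof (rule inj_onI)
    fix p q assume a: "p \<in> fixed s \<times> fixed t" "q \<in> fixed s \<times> fixed t"
      "(case p of (x, y) \<Rightarrow> x + y) = (case q of (x, y) \<Rightarrow> x + y)"
    obtain x y x' y' where pq: "p = (x, y)" "q = (x', y')" by (metis surj_pair)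
    have e: "x - x' = y' - y" using a(3) pq by (auto simp: algebra_simps)
    have "x - x' \<in> fixed s" using a pq fixed_closed(3)[OF assms(1)] by blast
    moreover have "x - x' \<in> fixed t" unfolding e using a pq fixed_closed(3)[OF assms(2)] by blast
    ultimately have "x - x' = 0" using fixed_inter[OF assms] by blast
    then show "p = q" using e pq by simp
  qed
  then have "card ((\<lambda>(x, y). x + y) ` (fixed s \<times> fixed t)) = CARD('f ^ 4)"
    using card3 by (simp add: card_image card_cartesian_product card_fixed assms)
  then have "(\<lambda>(x, y). x + y) ` (fixed s \<times> fixed t) = UNIV"
    by (simp add: card_subset_eq)
  then have "v \<in> (\<lambda>(x, y). x + y) ` (fixed s \<times> fixed t)" by simp
  then show thesis using that by auto
qed

text \<open>Each \<open>q\<close> commutes or anticommutes with \<open>t\<close>, so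
  \<open>q v\<close> is an eigenvector of \<open>t\<close> for 1 or -1. Equality follows by
  counting: 9 + 9 - 2 = 16.\<close>

lemma orbit_eq:
  assumes "t \<in> invs" "v \<noteq> 0" "v \<in> fixed t"
  shows "(\<lambda>q. q v) ` Q = (fixed t \<union> fixed (\<lambda>x. - t x)) - {0}"
proof (rule card_subset_eq)
  let ?n = "\<lambda>x. - t x"
  show "finite (fixed t \<union> fixed ?n - {0})" by simp
  have int: "fixed t \<inter> fixed ?n = {0}"
    using fixed_inter[OF assms(1) invs_neg] invs_neq_neg assms by blast
  have "card (fixed t \<union> fixed ?n) + card (fixed t \<inter> fixed ?n) = 18"
    using card_Un_Int[of "fixed t" "fixed ?n"] card_fixed assms(1) invs_neg by simp
  then have "card (fixed t \<union> fixed ?n - {0}) = 16"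
    using int fixed_closed(1)[OF assms(1)] by simp
  then show "card ((\<lambda>q. q v) ` Q) = card (fixed t \<union> fixed ?n - {0})"
    using orbit[OF assms(2)] by simp
  show "(\<lambda>q. q v) ` Q \<subseteq> fixed t \<union> fixed ?n - {0}"
  proof
    fix w assume "w \<in> (\<lambda>q. q v) ` Q"
    then obtain q where q: "q \<in> Q" "w = q v" by auto
    have "w \<noteq> 0" using q assms(2) zero[OF q(1)] injD[OF inj[OF q(1)], of v 0] by auto
    moreover have "t w = w \<or> t w = - w"
      using commutes[OF invs_in[OF assms(1)] q(1)] assms(3) q(2) by (auto simp: fixed_def)
    ultimately show "w \<in> fixed t \<union> fixed ?n - {0}"
      unfolding neg_fixed Un_iff Diff_iff by (auto simp: fixed_def)
  qed
qed

section \<open>The translation plane of the spread of fixed spaces\<close>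

definition blocks :: "('f ^ 4) set set"
  where "blocks = {(+) x ` fixed t | x t. t \<in> invs}"

lemma coset_iff: "y \<in> (+) x ` A \<longleftrightarrow> y - x \<in> A" for x y :: "'f ^ 4"
proof
  assume "y - x \<in> A"
  then have "x + (y - x) \<in> (+) x ` A" by (rule imageI)
  then show "y \<in> (+) x ` A" by simp
qed auto

lemma coset_eq:
  assumes "t \<in> invs" "y \<in> (+) x ` fixed t"
  shows "(+) x ` fixed t = (+) y ` fixed t"
proof -
  have d: "y - x \<in> fixed t" using assms coset_iff by blast
  have "w - x \<in> fixed t \<longleftrightarrow> w - y \<in> fixed t" for w
    using fixed_closed(2)[OF assms(1) _ d, of "w - y"] fixed_closed(3)[OF assms(1) _ d, of "w - x"]
    by auto
  then show ?thesis by (auto simp only: coset_iff set_eq_iff)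
qed

lemma card_block: "B \<in> blocks \<Longrightarrow> card B = 9"
  by (auto simp: blocks_def card_image card_fixed)

lemma block_through:
  assumes "x \<noteq> y"
  shows "\<exists>!B. B \<in> blocks \<and> x \<in> B \<and> y \<in> B"
proof -
  obtain t where t: "t \<in> invs" "y - x \<in> fixed t" using assms fixed_exists[of "y - x"] by auto
  show ?thesis
  proof (rule ex1I[of _ "(+) x ` fixed t"])
    show "(+) x ` fixed t \<in> blocks \<and> x \<in> (+) x ` fixed t \<and> y \<in> (+) x ` fixed t"
      using t fixed_closed(1)[OF t(1)] unfolding coset_iff blocks_def by auto
  next
    fix B assume B: "B \<in> blocks \<and> x \<in> B \<and> y \<in> B"
    then obtain w s where s: "s \<in> invs" "B = (+) w ` fixed s" by (auto simp: blocks_def)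
    then have Bx: "B = (+) x ` fixed s" using coset_eq B by blast
    then have "y - x \<in> fixed s" using B coset_iff by blast
    then have "s = t" using fixed_unique[OF s(1) t(1) _ _ t(2)] assms by simp
    then show "B = (+) x ` fixed t" using Bx by simp
  qed
qed

lemma blocks_two_design: "two_design 81 9 UNIV blocks"
proof -
  have "\<exists>!B. B \<in> blocks \<and> e \<subseteq> B" if e: "e \<in> nsets UNIV 2" for e
  proof -
    obtain x y where "x \<noteq> y" "e = {x, y}" using e by (auto simp: nsets_def card_2_iff)
    then show ?thesis using block_through by simp
  qed
  then show ?thesis
    using card3 card_block by (auto simp: two_design_def nsets_def)
qed

text \<open>Distinct blocks share no pair. Counting the 3240 pairs of points, 36 in each block,
  gives 90 blocks.\<close>

lemma blocks_partition: "partition_on (nsets UNIV 2) ((\<lambda>C. nsets C 2) ` blocks)"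
  and card_blocks: "card blocks = 90"
proof -
  have inj: "inj_on (\<lambda>C. nsets C 2) blocks"
    and disj: "\<And>B C. B \<in> blocks \<Longrightarrow> C \<in> blocks \<Longrightarrow> B \<noteq> C \<Longrightarrow> nsets B 2 \<inter> nsets C 2 = {}"
    and ne: "\<And>B. B \<in> blocks \<Longrightarrow> nsets B 2 \<noteq> {}"
  proof -
    show disj: "nsets B 2 \<inter> nsets C 2 = {}" if "B \<in> blocks" "C \<in> blocks" "B \<noteq> C" for B C
    proof (rule ccontr)
      assume "nsets B 2 \<inter> nsets C 2 \<noteq> {}"
      then obtain e where e: "e \<subseteq> B" "e \<subseteq> C" "card e = 2" by (auto simp: nsets_def)
      then obtain x y where "x \<noteq> y" "{x, y} \<subseteq> B" "{x, y} \<subseteq> C" by (metis card_2_iff)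
      then show False using block_through that by (metis insert_subset)
    qed
    show ne: "nsets B 2 \<noteq> {}" if "B \<in> blocks" for B
    proof -
      have "card (nsets B 2) \<noteq> 0" using card_block[OF that] by (simp add: choose_two)
      then show ?thesis by force
    qed
    show "inj_on (\<lambda>C. nsets C 2) blocks"
      using disj ne by (fastforce intro: inj_onI)
  qed
  have cover: "\<Union> ((\<lambda>C. nsets C 2) ` blocks) = nsets UNIV 2"
  proof (intro Set.set_eqI iffI)
    fix e assume e: "e \<in> nsets (UNIV :: ('f ^ 4) set) 2"
    then obtain B where "B \<in> blocks" "e \<subseteq> B" using blocks_two_design by (auto simp: two_design_def)
    then show "e \<in> \<Union> ((\<lambda>C. nsets C 2) ` blocks)" using e by (auto simp: nsets_def)
  qed (auto simp: nsets_def)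
  show part: "partition_on (nsets UNIV 2) ((\<lambda>C. nsets C 2) ` blocks)"
    unfolding partition_on_def disjoint_def using cover disj ne by (auto simp: eq_commute[of "{}"])
  have "card (nsets (UNIV :: ('f ^ 4) set) 2) = (\<Sum>p\<in>(\<lambda>C. nsets C 2) ` blocks. card p)"
    using product_partition[OF part] by (simp add: finite_imp_finite_nsets)
  also have "\<dots> = (\<Sum>C\<in>blocks. card (nsets C 2))" by (simp add: sum.reindex[OF inj])
  also have "\<dots> = (\<Sum>C\<in>blocks. 36)" by (rule sum.cong) (auto simp: card_block choose_two)
  finally show "card blocks = 90" using card3 by (simp add: choose_two)
qed

lemma blocks_affine_plane: "affine_plane UNIV blocks"
  unfolding affine_plane_def
proof (intro conjI ballI impI)
  show "blocks \<subseteq> Pow UNIV" by simp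
  show "\<exists>x\<in>L. \<exists>y\<in>L. x \<noteq> y" if "L \<in> blocks" for L
  proof -
    have "card L = 9" using card_block that .
    then have "\<not> is_singleton L" "L \<noteq> {}" by (auto simp: is_singleton_altdef)
    then show ?thesis by (metis all_not_in_conv is_singletonI')
  qed
  show "\<exists>!L. L \<in> blocks \<and> x \<in> L \<and> y \<in> L" if "x \<noteq> y" for x y
    using block_through[OF that] .
  show "\<exists>!L'. L' \<in> blocks \<and> x \<in> L' \<and> L \<inter> L' = {}" if L: "L \<in> blocks" "x \<in> UNIV - L" for L x
  proof -
    obtain w t where t: "t \<in> invs" "L = (+) w ` fixed t" using L by (auto simp: blocks_def)
    show ?thesis
    proof (rule ex1I[of _ "(+) x ` fixed t"])
      have "L \<inter> (+) x ` fixed t = {}"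
      proof (rule ccontr)
        assume "L \<inter> (+) x ` fixed t \<noteq> {}"
        then obtain y where y: "y \<in> (+) w ` fixed t" "y \<in> (+) x ` fixed t" using t by blast
        have "x \<in> (+) x ` fixed t" using fixed_closed(1)[OF t(1)] by (simp add: coset_iff)
        then have "x \<in> L" using coset_eq[OF t(1) y(1)] coset_eq[OF t(1) y(2)] t(2) by simp
        then show False using L by blast
      qed
      then show "(+) x ` fixed t \<in> blocks \<and> x \<in> (+) x ` fixed t \<and> L \<inter> (+) x ` fixed t = {}"
        using t fixed_closed(1)[OF t(1)] coset_iff[of x x "fixed t"] by (auto simp: blocks_def)
    next
      fix L' assume L': "L' \<in> blocks \<and> x \<in> L' \<and> L \<inter> L' = {}"
      then obtain w' s where s: "s \<in> invs" "L' = (+) w' ` fixed s" by (auto simp: blocks_def)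
      then have Lx: "L' = (+) x ` fixed s" using coset_eq L' by blast
      \<comment> \<open>Lines in different directions meet: splitting \<open>w - x\<close> along the
        two fixed spaces produces the common point \<open>x + a\<close>.\<close>
      have "s = t"
      proof (rule ccontr)
        assume "s \<noteq> t"
        then obtain a b where ab: "a \<in> fixed s" "b \<in> fixed t" "w - x = a + b"
          using fixed_sum[OF s(1) t(1)] by blast
        have "x + a = w + - b" using ab(3) by (simp add: algebra_simps)
        then have "x + a \<in> L" using fixed_closed(4)[OF t(1) ab(2)] t(2) by auto
        moreover have "x + a \<in> L'" using ab(1) Lx by auto
        ultimately have "x + a \<in> L \<inter> L'" ..
        then show False using L' by blast
      qed
      then show "L' = (+) x ` fixed t" using Lx by simp
    qed
  qed
  \<comment> \<open>A triangle: 0 and nonzero vectors from two different fixed spaces.\<close>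
  obtain v0 :: "'f ^ 4" where "v0 \<noteq> 0" by (metis zero_neq_one)
  then obtain t where t: "t \<in> invs" using fixed_exists by blast
  obtain s where s: "s \<in> invs" "s \<noteq> t" using second_involution[OF t] by blast
  obtain v where v: "v \<noteq> 0" "v \<in> fixed t" using fixed_nontrivial[OF t] by blast
  obtain w where w: "w \<noteq> 0" "w \<in> fixed s" using fixed_nontrivial[OF s(1)] by blast
  have "v \<noteq> w" using v w fixed_unique s t by blast
  moreover have "\<not> (\<exists>L\<in>blocks. {0, v, w} \<subseteq> L)"
  proof
    assume "\<exists>L\<in>blocks. {0, v, w} \<subseteq> L"
    then obtain x r where r: "r \<in> invs" "{0, v, w} \<subseteq> (+) x ` fixed r" by (auto simp: blocks_def)
    then have "{0, v, w} \<subseteq> (+) 0 ` fixed r" using coset_eq[OF r(1), of 0 x] by simp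
    then have "v \<in> fixed r" "w \<in> fixed r" by auto
    then show False using fixed_unique r s t v w by metis
  qed
  ultimately show "\<exists>x\<in>UNIV. \<exists>y\<in>UNIV. \<exists>z\<in>UNIV. x \<noteq> y \<and> x \<noteq> z \<and> y \<noteq> z \<and> \<not> (\<exists>L\<in>blocks. {x, y, z} \<subseteq> L)"
    using v(1) w(1) by (metis UNIV_I)
qed

text \<open>The eigenspaces of \<open>s\<close> and \<open>t\<close> cover at most 36 of the 81
  vectors; a vector outside them is fixed by a new involution.\<close>

lemma third_involution:
  assumes "s \<in> invs" "t \<in> invs"
  obtains r where "r \<in> invs" "r \<noteq> s" "r \<noteq> (\<lambda>x. - s x)" "r \<noteq> t" "r \<noteq> (\<lambda>x. - t x)"
proof -
  let ?S = "(fixed s \<union> fixed (\<lambda>x. - s x)) \<union> (fixed t \<union> fixed (\<lambda>x. - t x))"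
  have c: "card (fixed q \<union> fixed (\<lambda>x. - q x)) \<le> 18" if "q \<in> invs" for q
    using card_Un_le[of "fixed q" "fixed (\<lambda>x. - q x)"] card_fixed that invs_neg by simp
  have "card ?S \<le> 36"
    using card_Un_le[of "fixed s \<union> fixed (\<lambda>x. - s x)" "fixed t \<union> fixed (\<lambda>x. - t x)"]
      c[OF assms(1)] c[OF assms(2)] by linarith
  moreover have "CARD('f ^ 4) = 81" using card3 by simp
  ultimately have "?S \<noteq> UNIV" by auto
  then obtain v where v: "v \<notin> ?S" by blast
  then have "v \<noteq> 0" using fixed_closed(1)[OF assms(1)] by auto
  then obtain r where "r \<in> invs" "v \<in> fixed r" using fixed_exists by blast
  then show thesis using that v by blast
qed

section \<open>Coordinates over the nearfield of order 9\<close>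

lemma nearfield_distrib:
  "nearfield9_mult (x + y) m = nearfield9_mult x m + nearfield9_mult y (m :: 'f \<times> 'f)"
  using nearfield9_nearfield(1)[OF card3] unfolding nearfield_def by blast

text \<open>There are at most 81 lines with a slope and 9 vertical ones. An upper bound suffices,
  since 90 blocks will be mapped injectively to such lines.\<close>

lemma card_nearfield_lines: "card (nearfield_plane_lines (nearfield9_mult :: 'f \<times> 'f \<Rightarrow> _)) \<le> 90"
proof -
  let ?f = "\<lambda>(s, b). {(x, y). y = nearfield9_mult x s + (b :: 'f \<times> 'f)}"
  let ?g = "\<lambda>c :: 'f \<times> 'f. {(x, y :: 'f \<times> 'f). x = c}"
  have "card (range ?f) \<le> CARD(('f \<times> 'f) \<times> ('f \<times> 'f))"
    by (rule card_image_le) simp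
  moreover have "card (range ?g) \<le> CARD('f \<times> 'f)" by (rule card_image_le) simp
  moreover have "card (range ?f \<union> range ?g) \<le> card (range ?f) + card (range ?g)"
    by (rule card_Un_le)
  ultimately show ?thesis using card3 unfolding nearfield_plane_lines_def by simp
qed

text \<open>The line of slope \<open>s\<close> through the origin; with \<open>vertical_line\<close>
  these are the components of the spread of the nearfield plane.\<close>

definition spread_line :: "('f \<times> 'f) \<Rightarrow> (('f \<times> 'f) \<times> ('f \<times> 'f)) set"
  where "spread_line s = range (\<lambda>X. (X, nearfield9_mult X s))"

definition vertical_line :: "(('f \<times> 'f) \<times> ('f \<times> 'f)) set"
  where "vertical_line = range (\<lambda>Y. (0, Y))"

lemma card_spread_line: "card (spread_line s) = 9" "card vertical_line = 9"
proof -
  have "inj (\<lambda>X. (X, nearfield9_mult X s))" "inj (\<lambda>Y. (0 :: 'f \<times> 'f, Y :: 'f \<times> 'f))"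
    by (auto simp: inj_def)
  then show "card (spread_line s) = 9" "card vertical_line = 9"
    using card3 by (simp_all add: spread_line_def vertical_line_def card_image)
qed

text \<open>Right multiplication by \<open>s\<close> is additive, so translating by
  \<open>(a, b)\<close> only changes the intercept, to
  \<open>b - nearfield9_mult a s\<close>.\<close>

lemma spread_line_translate:
  "(+) p ` spread_line s \<in> nearfield_plane_lines nearfield9_mult"
  "(+) p ` vertical_line \<in> nearfield_plane_lines nearfield9_mult"
proof -
  obtain a b where p: "p = (a, b)" by (metis surj_pair)
  have "(+) p ` spread_line s = {(x, y). y = nearfield9_mult x s + (b - nearfield9_mult a s)}"
  proof (intro Set.set_eqI iffI)
    fix q assume "q \<in> (+) p ` spread_line s"
    then show "q \<in> {(x, y). y = nearfield9_mult x s + (b - nearfield9_mult a s)}"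
      by (auto simp: spread_line_def p nearfield_distrib)
  next
    fix q assume "q \<in> {(x, y). y = nearfield9_mult x s + (b - nearfield9_mult a s)}"
    then obtain x where q: "q = (x, nearfield9_mult x s + (b - nearfield9_mult a s))" by auto
    have "nearfield9_mult x s = nearfield9_mult (x - a) s + nearfield9_mult a s"
      using nearfield_distrib[of "x - a" a s] by simp
    then have "q = p + (x - a, nearfield9_mult (x - a) s)" by (simp add: q p)
    then show "q \<in> (+) p ` spread_line s" unfolding spread_line_def by blast
  qed
  then show "(+) p ` spread_line s \<in> nearfield_plane_lines nearfield9_mult"
    unfolding nearfield_plane_lines_def by auto
  have "(+) p ` vertical_line = {(x, y). x = a}"
  proof (intro Set.set_eqI iffI)
    fix q assume "q \<in> {(x :: 'f \<times> 'f, y :: 'f \<times> 'f). x = a}"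
    then have "q = p + (0, snd q - b)" by (cases q) (simp add: p)
    then show "q \<in> (+) p ` vertical_line" unfolding vertical_line_def by blast
  qed (auto simp: vertical_line_def p)
  then show "(+) p ` vertical_line \<in> nearfield_plane_lines nearfield9_mult"
    unfolding nearfield_plane_lines_def by auto
qed

text \<open>The squares are 0 and 1. The first claim makes \<open>u\<close> and \<open>A u\<close>
  independent below; the second makes a slope a nonsquare of GF(9).\<close>

lemma sum_squares_field3:
  fixes a b :: 'f
  shows "a * a + b * b = 0 \<Longrightarrow> a = 0 \<and> b = 0" "a * a + b * b = - 1 \<Longrightarrow> a \<noteq> 0 \<and> b \<noteq> 0"
  using field3_cases(1)[OF card3, of a] field3_cases(1)[OF card3, of b]
    field3_cases(2,3)[where 'f='f, OF card3] by (elim disjE; simp)+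

text \<open>An element of GF(9) with a zero coordinate is a square and multiplies as in the field.
  With both coordinates nonzero it is a nonsquare, and the cube conjugates \<open>X\<close>
  first.\<close>

lemma nearfield9_special:
  "nearfield9_mult X (0, 0) = (0 :: 'f \<times> 'f)"
  "nearfield9_mult X (1, 0) = (X :: 'f \<times> 'f)" "nearfield9_mult X (-1, 0) = - (X :: 'f \<times> 'f)"
  "nearfield9_mult X (0, 1) = (- snd X, fst X :: 'f)"
  "nearfield9_mult X (0, -1) = - (- snd X, fst X :: 'f)"
  "a \<noteq> 0 \<Longrightarrow> b \<noteq> 0 \<Longrightarrow>
    nearfield9_mult X (a, b) = (fst X * a + snd X * b, fst X * b - snd X * (a :: 'f))"
  by (cases X; simp add: nearfield9_mult_eq[OF card3] gf9_mult_def zero_prod_def)+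

text \<open>For involutions \<open>t\<^sub>0, t\<^sub>1, t\<^sub>2\<close> pairwise distinct up to sign, \<open>A = t\<^sub>1 t\<^sub>2\<close> acts on
  \<open>U = fixed (-t\<^sub>0)\<close> with square \<open>-1\<close>, so it identifies \<open>U\<close> with \<open>GF(9)\<close>, and \<open>t\<^sub>1\<close> identifies
  \<open>fixed t\<^sub>0\<close> with \<open>U\<close>. Any further involution \<open>t\<close> has fixed space \<open>{x + t\<^sub>1 (C x) | x \<in> U}\<close> where
  \<open>C = t\<^sub>1 t\<close> anticommutes with \<open>A\<close> and has square \<open>-1\<close>; this forces \<open>C\<close> to be a conjugation
  followed by multiplication by a nonsquare.\<close>

lemma nearfield_coordinates:
  obtains \<phi> :: "('f \<times> 'f) \<times> ('f \<times> 'f) \<Rightarrow> 'f ^ 4"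
  where "bij \<phi>" "\<forall>p q. \<phi> (p + q) = \<phi> p + \<phi> q"
    "\<forall>t\<in>invs. fixed t = \<phi> ` vertical_line \<or> (\<exists>s. fixed t = \<phi> ` spread_line s)"
proof -
  have "(1 :: 'f ^ 4) \<noteq> 0" by (metis zero_neq_one)
  then obtain t0 where t0: "t0 \<in> invs" using fixed_exists by blast
  obtain t1 where t1: "t1 \<in> invs" "t1 \<noteq> t0" "t1 \<noteq> (\<lambda>x. - t0 x)"
    using second_involution[OF t0] by blast
  obtain t2 where t2: "t2 \<in> invs" "t2 \<noteq> t0" "t2 \<noteq> (\<lambda>x. - t0 x)" "t2 \<noteq> t1" "t2 \<noteq> (\<lambda>x. - t1 x)"
    using third_involution[OF t0 t1(1)] by blast
  note tQ = invs_in[OF t0] invs_in[OF t1(1)] invs_in[OF t2(1)]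
  note t0m = minus[OF tQ(1)] and t1m = minus[OF tQ(2)] and t2m = minus[OF tQ(3)]
  have ac10: "t1 (t0 x) = - t0 (t1 x)" for x by (rule anticommute[OF t1(1) t0 t1(2,3)])
  have ac20: "t2 (t0 x) = - t0 (t2 x)" for x by (rule anticommute[OF t2(1) t0 t2(2,3)])
  have ac21: "t2 (t1 x) = - t1 (t2 x)" for x by (rule anticommute[OF t2(1) t1(1) t2(4,5)])
  define A where "A = (\<lambda>x. t1 (t2 x))"
  have AQ: "A \<in> Q" unfolding A_def by (rule comp[OF tQ(2,3)])
  have AA: "A (A x) = - x" for x
    by (simp add: A_def ac21 t1m t1(1) t2(1))
  define U where "U = fixed (\<lambda>x. - t0 x)"
  have U_iff: "x \<in> U \<longleftrightarrow> t0 x = - x" for x unfolding U_def by (rule neg_fixed)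
  obtain u where u: "u \<noteq> 0" "u \<in> U" using fixed_nontrivial[OF invs_neg[OF t0]] unfolding U_def by blast
  have t0A: "A (t0 x) = t0 (A x)" for x by (simp add: A_def ac20 ac10 t1m)
  \<comment> \<open>\<open>\<iota>\<close> identifies GF(9) with \<open>U\<close> so that
    \<open>A\<close> becomes multiplication by i.\<close>
  define \<iota> where "\<iota> X = fst X *s u + snd X *s A u" for X
  have \<iota>_add: "\<iota> (X + Y) = \<iota> X + \<iota> Y" for X Y
    by (simp add: \<iota>_def vec.scale_left_distrib)
  have \<iota>_minus: "\<iota> (- X) = - \<iota> X" for X
    by (simp add: \<iota>_def)
  have \<iota>_A: "A (\<iota> X) = \<iota> (- snd X, fst X)" for X
    by (simp add: \<iota>_def add[OF AQ] scale[OF AQ] AA vec.scale_minus_right vec.scale_minus_left)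
  have \<iota>_scale: "\<iota> (c * fst X, c * snd X) = c *s \<iota> X" for c X
    by (simp add: \<iota>_def vec.scale_right_distrib)
  have \<iota>_0: "X = 0" if X: "\<iota> X = 0" for X
  proof -
    obtain a b where ab: "X = (a, b)" by (metis surj_pair)
    have e1: "a *s u + b *s A u = 0" using X by (simp add: \<iota>_def ab)
    have "A (\<iota> X) = 0" using X zero[OF AQ] by simp
    then have e2: "- (b *s u) + a *s A u = 0" by (simp add: \<iota>_A) (simp add: \<iota>_def ab)
    \<comment> \<open>Multiplying by the conjugate \<open>a - b A\<close> leaves the norm
      \<open>a * a + b * b\<close>.\<close>
    have "a *s (a *s u + b *s A u) - b *s (- (b *s u) + a *s A u) = (a * a + b * b) *s u"
      by (simp add: vec_eq_iff algebra_simps)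
    then have "(a * a + b * b) *s u = 0" using e1 e2 by simp
    then have "a * a + b * b = 0" using u by simp
    then show ?thesis using sum_squares_field3(1)[of a b] by (simp add: ab zero_prod_def)
  qed
  have \<iota>_inj: "X = Y" if "\<iota> X = \<iota> Y" for X Y
    using \<iota>_0[of "X - Y"] that \<iota>_add[of X "- Y"] \<iota>_minus[of Y] by simp
  have \<iota>_U: "\<iota> X \<in> U" for X
  proof -
    have "A u \<in> U" using u t0A[of u] minus[OF AQ, of u] unfolding U_iff by simp
    then show ?thesis unfolding \<iota>_def U_def
      using u fixed_closed(2,5)[OF invs_neg[OF t0]] unfolding U_def by blast
  qed
  have \<iota>_surj: "\<exists>X. x = \<iota> X" if "x \<in> U" for x
  proof -
    have "card (range \<iota>) = 9"
      using card3 \<iota>_inj by (subst card_image) (auto simp: inj_def)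
    moreover have "card U = 9" unfolding U_def using card_fixed[OF invs_neg[OF t0]] .
    ultimately have "range \<iota> = U" using \<iota>_U by (intro card_subset_eq) auto
    then show ?thesis using that by blast
  qed
  \<comment> \<open>\<open>t1\<close> anticommutes with \<open>t0\<close>, so it carries
    \<open>U\<close> into \<open>fixed t0\<close>; the two coordinates follow the decomposition of
    the space into \<open>U\<close> and \<open>fixed t0\<close>.\<close>
  define \<phi> where "\<phi> p = \<iota> (fst p) + t1 (\<iota> (snd p))" for p
  have \<phi>_add: "\<phi> (p + q) = \<phi> p + \<phi> q" for p q
    by (simp add: \<phi>_def \<iota>_add add[OF tQ(2)])
  have \<phi>_minus: "\<phi> (- p) = - \<phi> p" for p
    by (simp add: \<phi>_def \<iota>_minus t1m)
  have t1U: "t0 (t1 (\<iota> Y)) = t1 (\<iota> Y)" for Y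
    using ac10[of "\<iota> Y"] \<iota>_U[of Y] t1m[of "\<iota> Y"] unfolding U_iff by simp
  have \<phi>_0: "p = 0" if p: "\<phi> p = 0" for p
  proof -
    have "\<iota> (fst p) = - t1 (\<iota> (snd p))" using p by (simp add: \<phi>_def eq_neg_iff_add_eq_0)
    then have "\<iota> (fst p) \<in> fixed t0" using t1U[of "snd p"] t0m by (simp add: fixed_def)
    moreover have "fixed t0 \<inter> U = {0}"
      unfolding U_def using fixed_inter[OF t0 invs_neg[OF t0] invs_neq_neg[OF t0]] .
    ultimately have z1: "\<iota> (fst p) = 0" using \<iota>_U by blast
    then have "t1 (\<iota> (snd p)) = 0" using p by (simp add: \<phi>_def)
    then have "\<iota> (snd p) = 0" using invs_sq[OF t1(1), of "\<iota> (snd p)"] zero[OF tQ(2)] by simp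
    then show ?thesis using z1 \<iota>_0 by (simp add: prod_eq_iff)
  qed
  have \<phi>_inj: "inj \<phi>"
  proof (rule injI)
    fix p q assume "\<phi> p = \<phi> q"
    then have "\<phi> (p + - q) = 0" unfolding \<phi>_add \<phi>_minus by simp
    from \<phi>_0[OF this] show "p = q" by simp
  qed
  have "card (range \<phi>) = CARD('f ^ 4)" using card3 \<phi>_inj by (simp add: card_image)
  then have "range \<phi> = UNIV" by (intro card_subset_eq) simp_all
  then have bij: "bij \<phi>" using \<phi>_inj by (simp add: bij_def)
  \<comment> \<open>Both sets have nine elements, so one inclusion is enough.\<close>
  have eqI: "fixed t = \<phi> ` L" if t: "t \<in> invs" and L: "card L = 9" and sub: "\<And>p. p \<in> L \<Longrightarrow> t (\<phi> p) = \<phi> p"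
    for t L
  proof -
    have "card (\<phi> ` L) = 9" using L \<phi>_inj by (simp add: card_image inj_on_subset)
    moreover have "\<phi> ` L \<subseteq> fixed t" using sub by (auto simp: fixed_def)
    ultimately show ?thesis using card_fixed[OF t] card_subset_eq[of "fixed t" "\<phi> ` L"] by simp
  qed
  \<comment> \<open>A point of the line with slope \<open>s\<close> is mapped by
    \<open>\<phi>\<close> to \<open>\<iota> X + t (\<iota> X)\<close>, which the involution
    \<open>t\<close> fixes.\<close>
  have slope: "fixed t = \<phi> ` spread_line s"
    if t: "t \<in> invs" and C: "\<And>X. t1 (t (\<iota> X)) = \<iota> (nearfield9_mult X s)" for t s
  proof (rule eqI[OF t card_spread_line(1)])
    fix p assume "p \<in> spread_line s"
    then obtain X where p: "p = (X, nearfield9_mult X s)" by (auto simp: spread_line_def)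
    have "\<phi> p = \<iota> X + t (\<iota> X)" using t1(1) by (simp add: p \<phi>_def C[symmetric])
    then show "t (\<phi> p) = \<phi> p" using t by (simp add: add invs_in add.commute)
  qed
  have "fixed t = \<phi> ` vertical_line \<or> (\<exists>s. fixed t = \<phi> ` spread_line s)" if t: "t \<in> invs" for t
  proof -
    \<comment> \<open>The six named involutions give the vertical line and the slopes 0, 1, -1, i,
      -i; any other one has a nonsquare slope.\<close>
    consider "t = t0" | "t = (\<lambda>x. - t0 x)" | "t = t1" | "t = (\<lambda>x. - t1 x)" | "t = t2" | "t = (\<lambda>x. - t2 x)"
      | "t \<noteq> t0" "t \<noteq> (\<lambda>x. - t0 x)" "t \<noteq> t1" "t \<noteq> (\<lambda>x. - t1 x)" "t \<noteq> t2" "t \<noteq> (\<lambda>x. - t2 x)"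
      by blast
    then show ?thesis
    proof cases
      case 1
      have "fixed t = \<phi> ` vertical_line"
        by (rule eqI[OF t card_spread_line(2)])
          (use \<iota>_add[of 0 0] in \<open>auto simp: vertical_line_def \<phi>_def 1 t1U\<close>)
      then show ?thesis ..
    next
      case 2
      have "t (\<phi> p) = \<phi> p" if p: "p \<in> spread_line (0, 0)" for p
      proof -
        obtain X where "p = (X, 0)" using p by (auto simp: spread_line_def nearfield9_special)
        then have "\<phi> p = \<iota> X" using \<iota>_add[of 0 0] zero[OF tQ(2)] by (simp add: \<phi>_def)
        then show ?thesis using \<iota>_U[of X] unfolding U_iff by (simp add: 2)
      qed
      then show ?thesis using eqI[OF t card_spread_line(1)] by blast
    next
      case 3
      have "t1 (t (\<iota> X)) = \<iota> (nearfield9_mult X (1, 0))" for X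
        using t1(1) by (simp add: nearfield9_special 3)
      then show ?thesis using slope[OF t] by blast
    next
      case 4
      have "t1 (t (\<iota> X)) = \<iota> (nearfield9_mult X (-1, 0))" for X
        unfolding nearfield9_special \<iota>_minus using t1(1) t1m by (simp add: 4)
      then show ?thesis using slope[OF t] by blast
    next
      case 5
      have "t1 (t (\<iota> X)) = \<iota> (nearfield9_mult X (0, 1))" for X
        using \<iota>_A[of X] by (simp add: nearfield9_special A_def 5)
      then show ?thesis using slope[OF t] by blast
    next
      case 6
      have "t1 (t (\<iota> X)) = \<iota> (nearfield9_mult X (0, -1))" for X
        unfolding nearfield9_special \<iota>_minus using \<iota>_A[of X] t1m by (simp add: A_def 6)
      then show ?thesis using slope[OF t] by blast
    next
      case 7
      have a0: "t (t0 x) = - t0 (t x)" for x by (rule anticommute[OF t t0 7(1,2)])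
      have a1: "t (t1 x) = - t1 (t x)" for x by (rule anticommute[OF t t1(1) 7(3,4)])
      have a2: "t (t2 x) = - t2 (t x)" for x by (rule anticommute[OF t t2(1) 7(5,6)])
      note tm = minus[OF invs_in[OF t]]
      define C where "C = (\<lambda>x. t1 (t x))"
      have CQ: "C \<in> Q" unfolding C_def by (rule comp[OF tQ(2) invs_in[OF t]])
      have CC: "C (C x) = - x" for x by (simp add: C_def a1 t1m t1(1) t)
      have CA: "C (A x) = - A (C x)" for x
        by (simp add: C_def A_def a1 a2 ac21 t1m t2m t1(1))
      have C0: "C (t0 x) = t0 (C x)" for x by (simp add: C_def a0 ac10 t1m)
      \<comment> \<open>\<open>C\<close> commutes with \<open>t0\<close> and so preserves
        \<open>U\<close>.\<close>
      have "C u \<in> U" using u C0[of u] minus[OF CQ, of u] unfolding U_iff by simp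
      then obtain a b where ab: "C u = \<iota> (a, b)" using \<iota>_surj by (metis surj_pair)
      \<comment> \<open>\<open>C\<close> is determined on \<open>U\<close> by \<open>C u\<close>,
        because anticommuting with \<open>A\<close> gives \<open>C (A u) = - A (C u)\<close>, with
        coordinates \<open>(b, - a)\<close>.\<close>
      have C\<iota>: "C (\<iota> X) = \<iota> (fst X * a + snd X * b, fst X * b - snd X * a)" for X
      proof -
        have "C (\<iota> X) = fst X *s \<iota> (a, b) + snd X *s \<iota> (b, - a)"
          unfolding \<iota>_def[of X] add[OF CQ] scale[OF CQ] CA ab \<iota>_A
          using \<iota>_minus[of "(- b, a)"] by simp
        also have "\<dots> = \<iota> ((fst X * a, fst X * b) + (snd X * b, snd X * - a))"
          using \<iota>_scale[of "fst X" "(a, b)"] \<iota>_scale[of "snd X" "(b, - a)"] by (simp only: \<iota>_add fst_conv snd_conv)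
        finally show ?thesis by simp
      qed
      \<comment> \<open>Evaluating the square of \<open>C\<close>, which is -1, at \<open>u\<close>
        shows that \<open>(a, b)\<close> has norm -1, so neither coordinate is 0.\<close>
      have "\<iota> (-1, 0) = C (C u)" by (simp add: CC) (simp add: \<iota>_def)
      also have "\<dots> = \<iota> (a * a + b * b, 0)" unfolding ab by (simp add: C\<iota> mult.commute)
      finally have "a * a + b * b = - 1" using \<iota>_inj by fastforce
      then have "a \<noteq> 0" "b \<noteq> 0" using sum_squares_field3(2)[of a b] by blast+
      then have "t1 (t (\<iota> X)) = \<iota> (nearfield9_mult X (a, b))" for X
        using C\<iota>[of X] by (simp add: nearfield9_special C_def)
      then show ?thesis using slope[OF t] by blast
    qed
  qed
  with bij \<phi>_add show thesis using that[of \<phi>] by blast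
qed

text \<open>The inverse of \<open>\<phi>\<close> is additive on images and sends cosets of fixed
  spaces to translates of lines through the origin. It maps the 90 blocks injectively into at most
  90 lines, hence onto all of them.\<close>

lemma blocks_nearfield_plane:
  "design_isomorphic UNIV blocks
    (UNIV :: (('f \<times> 'f) \<times> ('f \<times> 'f)) set) (nearfield_plane_lines nearfield9_mult)"
proof -
  obtain \<phi> :: "('f \<times> 'f) \<times> ('f \<times> 'f) \<Rightarrow> 'f ^ 4"
    where \<phi>: "bij \<phi>" "\<forall>p q. \<phi> (p + q) = \<phi> p + \<phi> q"
      "\<forall>t\<in>invs. fixed t = \<phi> ` vertical_line \<or> (\<exists>s. fixed t = \<phi> ` spread_line s)"
    by (rule nearfield_coordinates) (rule that)
  define \<psi> where "\<psi> = inv_into UNIV \<phi>"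
  have f: "bij \<psi>" unfolding \<psi>_def using \<phi>(1) by (rule bij_imp_bij_inv)
  have sub: "image \<psi> ` blocks \<subseteq> nearfield_plane_lines nearfield9_mult"
  proof (rule image_subsetI)
    fix B assume "B \<in> blocks"
    then obtain x t where t: "t \<in> invs" "B = (+) x ` fixed t" by (auto simp: blocks_def)
    obtain p where x: "x = \<phi> p" using bij_is_surj[OF \<phi>(1)] by blast
    have im: "\<psi> ` (+) x ` \<phi> ` L = (+) p ` L" for L
    proof -
      have "\<psi> (\<phi> p + \<phi> q) = p + q" for q
        unfolding \<psi>_def \<phi>(2)[rule_format, symmetric] by (rule inv_f_f[OF bij_is_inj[OF \<phi>(1)]])
      then show ?thesis unfolding x image_image by simp
    qed
    from bspec[OF \<phi>(3) t(1)]
    show "\<psi> ` B \<in> nearfield_plane_lines nearfield9_mult"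
      using spread_line_translate[of p] by (elim disjE exE) (simp_all only: t(2) im)
  qed
  have "inj_on (image \<psi>) blocks"
    by (rule inj_onI) (use inj_image_eq_iff[OF bij_is_inj[OF f]] in blast)
  then have "card (image \<psi> ` blocks) = 90" using card_blocks by (simp add: card_image)
  then have "image \<psi> ` blocks = nearfield_plane_lines nearfield9_mult"
    using card_nearfield_lines sub by (intro card_seteq) simp_all
  then show ?thesis using f unfolding design_isomorphic_def by blast
qed

end

section \<open>Permutation groups: orbits, stabilisers and extraspecial 2-groups\<close>

lemma perm_group_UNIV:
  fixes Q :: "('a \<Rightarrow> 'a) set"
  assumes "Q \<subseteq> Bij UNIV"
  shows "q \<in> Q \<Longrightarrow> r \<in> Q \<Longrightarrow> q \<otimes>\<^bsub>BijGroup UNIV\<^esub> r = (\<lambda>x. q (r x))"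
    and "\<one>\<^bsub>BijGroup (UNIV :: 'a set)\<^esub> = id"
  using assms by (auto simp: BijGroup_def compose_def subset_iff restrict_UNIV id_def)

lemma perm_group_inverse:
  assumes Q: "Q \<subseteq> Bij UNIV" and grp: "group (perm_group UNIV Q)" and q: "q \<in> Q"
  obtains r where "r \<in> Q" "\<And>x. q (r x) = x" "\<And>x. r (q x) = x"
proof -
  interpret group "perm_group UNIV Q" by fact
  let ?r = "inv\<^bsub>perm_group UNIV Q\<^esub> q"
  have r: "?r \<in> Q" using inv_closed[of q] q by simp
  have "(\<lambda>x. q (?r x)) = id" "(\<lambda>x. ?r (q x)) = id"
    using r_inv[of q] l_inv[of q] q r perm_group_UNIV[OF Q] by simp_all
  then show thesis using that[OF r] by (metis id_apply)
qed

text \<open>The fibres of evaluation at \<open>v\<close> have equal size: composing with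
  \<open>p\<close> and with its inverse matches the fibre over \<open>p v\<close> with the
  stabiliser.\<close>

lemma perm_group_orbit_stabiliser:
  assumes Q: "Q \<subseteq> Bij UNIV" and grp: "group (perm_group UNIV Q)" and fin: "finite Q"
  shows "card Q = card ((\<lambda>q. q v) ` Q) * card {q \<in> Q. q v = v}"
proof -
  interpret group "perm_group UNIV Q" by fact
  have closed: "(\<lambda>x. q (r x)) \<in> Q" if "q \<in> Q" "r \<in> Q" for q r
    using m_closed[of q r] that perm_group_UNIV(1)[OF Q that] by simp
  have fibre: "card {q \<in> Q. q v = w} = card {q \<in> Q. q v = v}" if w: "w \<in> (\<lambda>q. q v) ` Q" for w
  proof -
    obtain p where p: "p \<in> Q" "w = p v" using w by auto
    obtain p' where p': "p' \<in> Q" "\<And>x. p (p' x) = x" "\<And>x. p' (p x) = x"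
      by (rule perm_group_inverse[OF Q grp p(1)]) (rule that)
    have "bij_betw (\<lambda>q x. p (q x)) {q \<in> Q. q v = v} {q \<in> Q. q v = w}"
      by (rule bij_betw_byWitness[where f'="\<lambda>q x. p' (q x)"])
        (use p p' closed in auto)
    then show ?thesis by (simp add: bij_betw_same_card)
  qed
  have "card Q = (\<Sum>w\<in>(\<lambda>q. q v) ` Q. card {q \<in> Q. q v = w})"
    using sum.image_gen[OF fin, of "\<lambda>_. 1::nat" "\<lambda>q. q v"] by simp
  also have "\<dots> = (\<Sum>w\<in>(\<lambda>q. q v) ` Q. card {q \<in> Q. q v = v})"
    by (rule sum.cong) (simp_all add: fibre)
  finally show ?thesis by simp
qed

text \<open>\<open>z\<close> is the nonidentity element of the centre of order 2. Its square is
  central and differs from \<open>z\<close>, hence is \<open>id\<close>; the abelian quotient by the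
  centre controls commutators.\<close>

lemma extraspecial_2_perm_group:
  assumes Q: "Q \<subseteq> Bij UNIV" and ex: "extraspecial 2 (perm_group UNIV Q)"
  obtains z where "z \<in> Q" "z \<noteq> id" "\<And>x. z (z x) = x" "\<And>q x. q \<in> Q \<Longrightarrow> q (z x) = z (q x)"
    "\<And>q r. q \<in> Q \<Longrightarrow> r \<in> Q \<Longrightarrow> (\<forall>x. q (r x) = r (q x)) \<or> (\<forall>x. q (r x) = z (r (q x)))"
proof -
  let ?H = "perm_group UNIV Q"
  let ?Z = "group_centre ?H"
  interpret group ?H using ex by (simp add: extraspecial_def)
  note mult = perm_group_UNIV(1)[OF Q] and one = perm_group_UNIV(2)[OF Q]
  have closed: "(\<lambda>x. q (r x)) \<in> Q" if "q \<in> Q" "r \<in> Q" for q r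
    using m_closed[of q r] that mult[OF that] by simp
  have Z_iff: "y \<in> ?Z \<longleftrightarrow> y \<in> Q \<and> (\<forall>q\<in>Q. \<forall>x. y (q x) = q (y x))" for y
    unfolding group_centre_def by (auto simp: mult fun_eq_iff)
  have idQ: "id \<in> Q" using one_closed one by simp
  then have idZ: "id \<in> ?Z" unfolding Z_iff by simp
  have "card ?Z = 2" using ex by (simp add: extraspecial_def)
  then obtain z where z: "z \<noteq> id" "?Z = {id, z}" using idZ
    unfolding card_2_iff by (metis insert_commute insert_iff singletonD)
  then have zQ: "z \<in> Q" and zc: "\<And>q x. q \<in> Q \<Longrightarrow> z (q x) = q (z x)" using Z_iff[of z] by auto
  have "(\<lambda>x. z (z x)) \<in> ?Z" unfolding Z_iff using closed[OF zQ zQ] zc by simp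
  moreover have "(\<lambda>x. z (z x)) \<noteq> z"
  proof
    assume "(\<lambda>x. z (z x)) = z"
    then have "z (z x) = z x" for x by metis
    moreover have "inj z" using zQ Q by (auto simp: Bij_def bij_betw_def)
    ultimately have "z x = x" for x by (simp add: inj_eq)
    then show False using z(1) by auto
  qed
  ultimately have zz: "z (z x) = x" for x using z(2) by (metis empty_iff id_apply insert_iff)
  have comm: "(\<forall>x. q (r x) = r (q x)) \<or> (\<forall>x. q (r x) = z (r (q x)))" if qr: "q \<in> Q" "r \<in> Q" for q r
  proof -
    have "comm_group (?H Mod ?Z)" using ex by (simp add: extraspecial_def elementary_abelian_def)
    then have "(?Z #>\<^bsub>?H\<^esub> q) <#>\<^bsub>?H\<^esub> (?Z #>\<^bsub>?H\<^esub> r) = (?Z #>\<^bsub>?H\<^esub> r) <#>\<^bsub>?H\<^esub> (?Z #>\<^bsub>?H\<^esub> q)"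
      using comm_groupE(4)[of "?H Mod ?Z" "?Z #>\<^bsub>?H\<^esub> q" "?Z #>\<^bsub>?H\<^esub> r"] qr
      by (auto simp: FactGroup_def RCOSETS_def)
    moreover have "q \<in> ?Z #>\<^bsub>?H\<^esub> q" "r \<in> ?Z #>\<^bsub>?H\<^esub> r"
      using idZ qr idQ mult unfolding r_coset_def by (auto intro!: bexI[of _ id])
    \<comment> \<open>The product lies in the coset product taken in the opposite order, so it is
      \<open>r\<close> after \<open>q\<close> up to two central factors, each \<open>id\<close> or
      \<open>z\<close>.\<close>
    ultimately have "q \<otimes>\<^bsub>?H\<^esub> r \<in> (?Z #>\<^bsub>?H\<^esub> r) <#>\<^bsub>?H\<^esub> (?Z #>\<^bsub>?H\<^esub> q)"
      unfolding set_mult_def by blast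
    then obtain h k where hk: "h \<in> ?Z" "k \<in> ?Z" "q \<otimes>\<^bsub>?H\<^esub> r = (h \<otimes>\<^bsub>?H\<^esub> r) \<otimes>\<^bsub>?H\<^esub> (k \<otimes>\<^bsub>?H\<^esub> q)"
      unfolding set_mult_def r_coset_def by blast
    have hkQ: "h \<in> Q" "k \<in> Q" using hk Z_iff by blast+
    have "q (r x) = h (r (k (q x)))" for x
      using hk(3) hkQ qr closed by (simp add: mult fun_eq_iff)
    moreover have "h = id \<or> h = z" "k = id \<or> k = z" using hk z(2) by auto
    ultimately show ?thesis using zc[OF qr(2)] zz by (elim disjE) simp_all
  qed
  show thesis by (rule that[OF zQ z(1) zz zc[symmetric] comm])
qed

section \<open>Valency of Hamming graphs, images of cliques, and design automorphisms\<close>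

lemma hamming2_degree:
  assumes "u \<in> hamming2_verts n"
  shows "card {w. {u, w} \<in> hamming2_edges n} = 2 * (n - 1)"
proof -
  obtain a b where u: "u = (a, b)" "a < n" "b < n" using assms by (auto simp: hamming2_verts_def)
  have "{w. {u, w} \<in> hamming2_edges n} = ({..<n} - {a}) \<times> {b} \<union> {a} \<times> ({..<n} - {b})"
    using u by (auto simp: hamming2_edges_def hamming2_verts_def doubleton_eq_iff)
  also have "card \<dots> = card (({..<n} - {a}) \<times> {b}) + card ({a} \<times> ({..<n} - {b}))"
    by (rule card_Un_disjoint) auto
  also have "\<dots> = 2 * (n - 1)" using u by (simp add: card_cartesian_product)
  finally show ?thesis .
qed

lemma graph_isomorphic_hamming2_degree:
  assumes "graph_isomorphic UNIV P (hamming2_verts n) (hamming2_edges n)"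
  shows "card {y. {x, y} \<in> P} = 2 * (n - 1)"
proof -
  obtain f where f: "bij_betw f UNIV (hamming2_verts n)"
    "\<And>x y. {x, y} \<in> P \<longleftrightarrow> {f x, f y} \<in> hamming2_edges n"
    using assms by (auto simp: graph_isomorphic_def)
  have "f ` {y. {x, y} \<in> P} = {w. {f x, w} \<in> hamming2_edges n}"
  proof (intro Set.set_eqI iffI)
    fix w assume w: "w \<in> {w. {f x, w} \<in> hamming2_edges n}"
    then have "w \<in> hamming2_verts n" by (auto simp: hamming2_edges_def doubleton_eq_iff)
    then obtain y where "w = f y" using f(1) by (auto simp: bij_betw_def)
    then show "w \<in> f ` {y. {x, y} \<in> P}" using w f(2) by auto
  qed (auto simp: f(2))
  moreover have "card (f ` {y. {x, y} \<in> P}) = card {y. {x, y} \<in> P}"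
    using f(1) by (intro card_image) (auto simp: bij_betw_def intro: inj_on_subset)
  moreover have "f x \<in> hamming2_verts n" using f(1) by (auto simp: bij_betw_def)
  ultimately show ?thesis using hamming2_degree by simp
qed

lemma maximal_cliques_image:
  assumes g: "bij g" and C: "C \<in> maximal_cliques UNIV P"
  shows "g ` C \<in> maximal_cliques UNIV (image g ` P)"
proof -
  define h where "h = inv_into UNIV g"
  have hg: "h (g x) = x" for x unfolding h_def using g by (simp add: bij_is_inj)
  have gh: "g (h y) = y" for y unfolding h_def using g by (simp add: bij_is_surj surj_f_inv_f)
  have cl: "clique C P" and max: "\<And>C'. C \<subseteq> C' \<Longrightarrow> clique C' P \<Longrightarrow> C' = C"
    using C by (auto simp: maximal_cliques_def)
  have im: "{g x, g y} \<in> image g ` P \<longleftrightarrow> {x, y} \<in> P" for x y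
  proof
    assume "{g x, g y} \<in> image g ` P"
    then obtain e where e: "e \<in> P" "g ` {x, y} = g ` e" by auto
    have "{x, y} = e" by (rule iffD1[OF inj_image_eq_iff[OF bij_is_inj[OF g]] e(2)])
    then show "{x, y} \<in> P" using e by simp
  next
    assume "{x, y} \<in> P"
    then have "g ` {x, y} \<in> image g ` P" by blast
    then show "{g x, g y} \<in> image g ` P" by simp
  qed
  have "clique (g ` C) (image g ` P)"
    using cl unfolding clique_def by (auto simp: im)
  moreover have "C' = g ` C" if C': "g ` C \<subseteq> C'" "clique C' (image g ` P)" for C'
  proof -
    have "C \<subseteq> h ` C'"
    proof
      fix x assume "x \<in> C"
      then have "g x \<in> C'" using C'(1) by blast
      then have "h (g x) \<in> h ` C'" by (rule imageI)
      then show "x \<in> h ` C'" by (simp add: hg)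
    qed
    moreover have "clique (h ` C') P" unfolding clique_def
    proof (intro ballI impI)
      fix v w assume "v \<in> h ` C'" "w \<in> h ` C'" "v \<noteq> w"
      then obtain v' w' where vw: "v' \<in> C'" "w' \<in> C'" "v = h v'" "w = h w'" "v' \<noteq> w'" by auto
      then have "{g v, g w} \<in> image g ` P" using C'(2) by (simp add: clique_def gh)
      then show "{v, w} \<in> P" by (simp only: im)
    qed
    ultimately have "h ` C' = C" by (rule max)
    then have "g ` h ` C' = g ` C" by simp
    then show ?thesis by (simp add: image_image gh)
  qed
  ultimately show ?thesis unfolding maximal_cliques_def by auto
qed

text \<open>The setwise stabiliser of the block set is a subgroup of \<open>BijGroup V\<close>. Its
  elements are extensional on \<open>V\<close>, so inverses and products act on blocks as expected
  because blocks lie inside \<open>V\<close>.\<close>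

lemma subgroup_design_Aut:
  assumes G: "subgroup G (BijGroup V)" and inv: "\<And>g. g \<in> G \<Longrightarrow> image g ` \<B> = \<B>"
    and sub: "\<B> \<subseteq> Pow V"
  shows "subgroup G (design_Aut V \<B>)"
proof -
  interpret B: group "BijGroup V" by (rule group_BijGroup)
  let ?K = "{g \<in> Bij V. image g ` \<B> = \<B>}"
  have carr: "carrier (BijGroup V) = Bij V" by (simp add: BijGroup_def)
  have "subgroup ?K (BijGroup V)"
  proof (rule B.subgroupI)
    show "?K \<subseteq> carrier (BijGroup V)" by (auto simp: carr)
    have "image (\<lambda>x\<in>V. x) ` \<B> = \<B>"
    proof -
      have "(\<lambda>x\<in>V. x) ` C = C" if "C \<in> \<B>" for C using that sub by force
      then show ?thesis by simp
    qed
    then show "?K \<noteq> {}" using id_Bij by blast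
  next
    fix g assume g: "g \<in> ?K"
    have eq: "inv\<^bsub>BijGroup V\<^esub> g = (\<lambda>x\<in>V. inv_into V g x)" using g by (simp add: inv_BijGroup)
    have "(\<lambda>x\<in>V. inv_into V g x) ` g ` C = C" if "C \<in> \<B>" for C
    proof -
      have C: "C \<subseteq> V" using that sub by auto
      have "(\<lambda>x\<in>V. inv_into V g x) (g x) = x" if "x \<in> C" for x
        using that C g by (auto simp: Bij_def bij_betw_def subset_iff)
      then show ?thesis unfolding image_image by (simp only: image_cong[OF refl] image_ident)
    qed
    then have "image (\<lambda>x\<in>V. inv_into V g x) ` (image g ` \<B>) = \<B>" by (simp add: image_image)
    then show "inv\<^bsub>BijGroup V\<^esub> g \<in> ?K" using g restrict_inv_into_Bij[of g V] by (simp add: eq)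
  next
    fix g h assume gh: "g \<in> ?K" "h \<in> ?K"
    have eq: "g \<otimes>\<^bsub>BijGroup V\<^esub> h = compose V g h" using gh by (simp add: BijGroup_def)
    have "compose V g h ` C = g ` h ` C" if "C \<in> \<B>" for C
      using that sub by (force simp: compose_def image_image)
    then have "image (compose V g h) ` \<B> = image g ` image h ` \<B>" by (simp add: image_image)
    then show "g \<otimes>\<^bsub>BijGroup V\<^esub> h \<in> ?K" using gh compose_Bij[of g V h] by (simp add: eq)
  qed
  moreover have "G \<subseteq> ?K" using subgroup.subset[OF G] inv by (auto simp: carr)
  ultimately show ?thesis unfolding design_Aut_def using B.subgroup_incl[OF G] by blast
qed

section \<open>From the homogeneous factorisation to the spread\<close>

theorem theorem6p11:
  fixes \<E> :: "('f::{field,finite} ^ 4) set set set"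
    and M G G\<^sub>0 Q :: "('f ^ 4 \<Rightarrow> 'f ^ 4) set"
    and \<B> :: "('f ^ 4) set set"
  assumes "CARD('f) = 3"
    and "homogeneous_factorisation 5 M G UNIV \<E>"
    and "\<forall>P\<in>\<E>. arc_transitive_on M UNIV P"
    and "\<forall>P\<in>\<E>. graph_isomorphic UNIV P (hamming2_verts 9) (hamming2_edges 9)"
    and "subgroup G AGL"
    and "G\<^sub>0 = {g \<in> G. g 0 = 0}"
    and "internal_semidirect_product (perm_group UNIV G) translation_group G\<^sub>0"
    and "two_transitive_on G UNIV"
    and "Q \<lhd> perm_group UNIV G\<^sub>0"
    and "extraspecial 2 (perm_group UNIV Q)"
    and "card Q = 2 ^ 5"
    and "\<exists>H. subgroup H (sym_group 5) \<and>
             perm_group UNIV G\<^sub>0 Mod Q \<cong> (sym_group 5)\<lparr>carrier := H\<rparr>"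
    and "internal_semidirect_product (perm_group UNIV M) translation_group Q"
    and "\<B> = (\<Union>P\<in>\<E>. maximal_cliques UNIV P)"
  shows "(\<forall>C\<in>\<B>. card C = 9) \<and> card \<B> = 90 \<and>
         partition_on (nsets UNIV 2) ((\<lambda>C. nsets C 2) ` \<B>) \<and>
         two_design 81 9 UNIV \<B> \<and>
         subgroup G (design_Aut UNIV \<B>) \<and> two_transitive_on G UNIV \<and>
         affine_plane UNIV \<B> \<and>
         design_isomorphic UNIV \<B>
           (UNIV :: (('f \<times> 'f) \<times> ('f \<times> 'f)) set) (nearfield_plane_lines nearfield9_mult)"
proof -
  have part: "partition_on (nsets UNIV 2) \<E>" and sG: "subgroup G (BijGroup UNIV)"
    and Gperm: "\<And>g P. g \<in> G \<Longrightarrow> P \<in> \<E> \<Longrightarrow> image g ` P \<in> \<E>"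
    and M: "M = {g \<in> G. \<forall>P\<in>\<E>. image g ` P = P}"
    using assms(2) unfolding homogeneous_factorisation_def by blast+
  have G_Bij: "G \<subseteq> Bij UNIV" using subgroup.subset[OF sG] by (simp add: BijGroup_def)
  then have M_Bij: "M \<subseteq> Bij UNIV" using M by blast
  have "subgroup Q (perm_group UNIV G\<^sub>0)" using assms(9) by (rule normal_imp_subgroup)
  from subgroup.subset[OF this] have QG: "Q \<subseteq> G" and Q0: "\<And>q. q \<in> Q \<Longrightarrow> q 0 = 0"
    using assms(6) by auto
  have Q_Bij: "Q \<subseteq> Bij UNIV" using QG G_Bij by blast
  have linear: "\<exists>A. q = (*v) A" if q: "q \<in> Q" for q
  proof -
    have "q \<in> affine_linear_maps"
      using q QG subgroup.subset[OF assms(5)] by (auto simp: AGL_def)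
    then obtain A b where "q = (\<lambda>x. A *v x + b)" by (auto simp: affine_linear_maps_def)
    moreover from this have "b = 0" using Q0[OF q] by simp
    ultimately show ?thesis by auto
  qed
  have grp: "group (perm_group UNIV Q)" using assms(10) by (simp add: extraspecial_def)
  have sd: "translation_group \<lhd> perm_group UNIV M" "subgroup Q (perm_group UNIV M)"
    "translation_group <#>\<^bsub>perm_group UNIV M\<^esub> Q = M"
    using assms(13) by (simp_all add: internal_semidirect_product_def)
  have TM: "translation_group \<subseteq> M"
    using subgroup.subset[OF normal_imp_subgroup[OF sd(1)]] by simp
  have QM: "Q \<subseteq> M" using subgroup.subset[OF sd(2)] by simp
  \<comment> \<open>\<open>Q\<close> is the stabiliser of 0 in \<open>M\<close>: if a translation
    after \<open>q\<close> fixes 0, the translation is trivial.\<close>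
  have M0: "m \<in> Q" if m: "m \<in> M" "m 0 = 0" for m
  proof -
    obtain \<tau> q where \<tau>: "\<tau> \<in> translation_group" "q \<in> Q" "m = \<tau> \<otimes>\<^bsub>BijGroup UNIV\<^esub> q"
      using m(1) sd(3) by (auto simp: set_mult_def)
    then obtain b where b: "\<tau> = (\<lambda>x. x + b)" by (auto simp: translation_group_def)
    have "m = (\<lambda>x. \<tau> (q x))" using \<tau> perm_group_UNIV(1)[OF M_Bij] TM QM by blast
    then show ?thesis using m(2) b Q0[OF \<tau>(2)] \<tau>(2) by simp
  qed
  have M_edge: "{m x, m y} \<in> P" if "m \<in> M" "P \<in> \<E>" "{x, y} \<in> P" for m P x y
  proof -
    have "m ` {x, y} \<in> image m ` P" using that by blast
    then show ?thesis using that M by simp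
  qed
  \<comment> \<open>Each factor is invariant under translations, so it is a Cayley graph.\<close>
  have edge: "{x, y} \<in> P \<longleftrightarrow> {0, y - x} \<in> P" if P: "P \<in> \<E>" for P x y
  proof -
    have T: "(\<lambda>z. z + b) \<in> M" for b using TM by (auto simp: translation_group_def)
    show ?thesis using M_edge[OF T P, of x y "- x"] M_edge[OF T P, of 0 "y - x" x] by auto
  qed
  have part_exists: "\<exists>P\<in>\<E>. {0, v} \<in> P" if "v \<noteq> 0" for v
    using that partition_onD1[OF part] by (metis UNIV_I UnionE doubleton_in_nsets_2)
  have no_loop: "x \<noteq> y" if "P \<in> \<E>" "{x, y} \<in> P" for P x y
    using that partition_onD1[OF part] by (metis UnionI doubleton_in_nsets_2)
  \<comment> \<open>Arc-transitivity moves the arc from 0 to \<open>v\<close> onto the arc from 0 to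
    \<open>w\<close> by an element of \<open>M\<close> fixing 0, which lies in
    \<open>Q\<close>.\<close>
  have nbh: "{w. {0, w} \<in> P} = (\<lambda>q. q v) ` Q" if P: "P \<in> \<E>" and v: "{0, v} \<in> P" for P v
  proof (intro Set.set_eqI iffI)
    have arc: "\<forall>x y x' y'. {x, y} \<in> P \<longrightarrow> {x', y'} \<in> P \<longrightarrow> (\<exists>g\<in>M. g x = x' \<and> g y = y')"
      using bspec[OF assms(3) P] by (simp add: arc_transitive_on_def)
    fix w assume "w \<in> {w. {0, w} \<in> P}"
    then obtain g where "g \<in> M" "g 0 = 0" "g v = w"
      using arc[rule_format, OF v, of 0 w] by blast
    then show "w \<in> (\<lambda>q. q v) ` Q" using M0 by blast
  next
    fix w assume "w \<in> (\<lambda>q. q v) ` Q"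
    then obtain q where q: "q \<in> Q" "w = q v" by blast
    have "{q 0, q v} \<in> P" by (rule M_edge[OF _ P v]) (use q QM in blast)
    then show "w \<in> {w. {0, w} \<in> P}" using q Q0[OF q(1)] by simp
  qed
  \<comment> \<open>The orbit is a neighbourhood in a factor, whose valency is that of H(9,2),
    namely 16.\<close>
  have orbit: "card ((\<lambda>q. q v) ` Q) = 16" if v: "v \<noteq> 0" for v
  proof -
    obtain P where P: "P \<in> \<E>" "{0, v} \<in> P" using part_exists[OF v] by blast
    show ?thesis
      using nbh[OF P] graph_isomorphic_hamming2_degree[OF bspec[OF assms(4) P(1)], of 0] by simp
  qed
  have finQ: "finite Q" using assms(11) by (intro card_ge_0_finite) simp
  have idQ: "id \<in> Q"
    using monoid.one_closed[OF group.is_monoid[OF grp]] perm_group_UNIV(2)[OF Q_Bij] by simp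
  have stab: "\<exists>!t. t \<in> Q \<and> t \<noteq> id \<and> t v = v" if v: "v \<noteq> 0" for v
  proof -
    \<comment> \<open>\<open>Q\<close> has order 32 and the orbit has length 16.\<close>
    have "card {q \<in> Q. q v = v} = 2"
      using perm_group_orbit_stabiliser[OF Q_Bij grp finQ, of v] orbit[OF v] assms(11) by simp
    then have "card ({q \<in> Q. q v = v} - {id}) = 1" using idQ by simp
    then obtain t where "{q \<in> Q. q v = v} - {id} = {t}" by (auto simp: card_1_singleton_iff)
    then show ?thesis by (intro ex1I[of _ t]) blast+
  qed
  obtain z where z: "z \<in> Q" "z \<noteq> id" "\<And>x. z (z x) = x" "\<And>q x. q \<in> Q \<Longrightarrow> q (z x) = z (q x)"
    "\<And>q r. q \<in> Q \<Longrightarrow> r \<in> Q \<Longrightarrow> (\<forall>x. q (r x) = r (q x)) \<or> (\<forall>x. q (r x) = z (r (q x)))"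
    by (rule extraspecial_2_perm_group[OF Q_Bij assms(10)]) (rule that)
  interpret extraspecial_spread Q z
  proof
    fix q r x y c
    assume q: "q \<in> Q"
    obtain A where A: "q = (*v) A" using linear[OF q] by blast
    show "q (x + y) = q x + q y" unfolding A by (rule matrix_vector_right_distrib)
    show "q (c *s x) = c *s q x" unfolding A by (rule vector_scalar_commute)
    show "inj q" using q Q_Bij by (auto simp: Bij_def bij_betw_def)
    assume r: "r \<in> Q"
    show "(\<lambda>x. q (r x)) \<in> Q"
      using monoid.m_closed[OF group.is_monoid[OF grp], of q r] q r
        perm_group_UNIV(1)[OF Q_Bij q r] by simp
  qed (fact assms(1) z orbit stab)+
  have factor: "{x, y} \<in> P \<longleftrightarrow> x \<noteq> y \<and> y - x \<in> fixed t \<union> fixed (\<lambda>x. - t x)"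
    if P: "P \<in> \<E>" "{0, v} \<in> P" and t: "t \<in> invs" "v \<in> fixed t" for P v t x y
  proof -
    have v: "v \<noteq> 0" using no_loop[OF P] by simp
    have "{w. {0, w} \<in> P} = fixed t \<union> fixed (\<lambda>x. - t x) - {0}"
      using nbh[OF P] orbit_eq[OF t(1) v t(2)] by simp
    then have "{0, y - x} \<in> P \<longleftrightarrow> y - x \<in> fixed t \<union> fixed (\<lambda>x. - t x) - {0}" by blast
    then show ?thesis using edge[OF P(1), of x y] by auto
  qed
  have cliques: "maximal_cliques UNIV P =
      range (\<lambda>x. (+) x ` fixed t) \<union> range (\<lambda>x. (+) x ` fixed (\<lambda>x. - t x))"
    if P: "P \<in> \<E>" "{0, v} \<in> P" and t: "t \<in> invs" "v \<in> fixed t" for P v t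
  proof (rule maximal_cliques_two_subgroups)
    note n = invs_neg[OF t(1)]
    show "x - y \<in> fixed t" if "x \<in> fixed t" "y \<in> fixed t" for x y
      using fixed_closed(3)[OF t(1) that] .
    show "x - y \<in> fixed (\<lambda>x. - t x)" if "x \<in> fixed (\<lambda>x. - t x)" "y \<in> fixed (\<lambda>x. - t x)" for x y
      using fixed_closed(3)[OF n that] .
    show "fixed t \<inter> fixed (\<lambda>x. - t x) = {0}"
      by (rule fixed_inter[OF t(1) n invs_neq_neg[OF t(1)]])
    show "fixed t \<noteq> {0}" "fixed (\<lambda>x. - t x) \<noteq> {0}"
      using card_fixed[OF t(1)] card_fixed[OF n] by auto
  qed (rule factor[OF P t])
  \<comment> \<open>The factor containing the pair of 0 and \<open>v\<close> contributes the cosets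
    of \<open>fixed t\<close> and of the fixed space of \<open>-t\<close>, where \<open>t\<close>
    fixes \<open>v\<close>. Every factor contains such a pair, and every \<open>t\<close> in
    \<open>invs\<close> fixes some nonzero \<open>v\<close>.\<close>
  have \<B>: "\<B> = blocks"
  proof (rule subset_antisym)
    show "\<B> \<subseteq> blocks"
    proof
      fix C assume "C \<in> \<B>"
      then obtain P where P: "P \<in> \<E>" "C \<in> maximal_cliques UNIV P" using assms(14) by blast
      have "P \<noteq> {}" using partition_onD3[OF part] P(1) by blast
      moreover have "P \<subseteq> nsets UNIV 2" using partition_onD1[OF part] P(1) by blast
      ultimately obtain e where e: "e \<in> P" "e \<in> nsets UNIV 2" by blast
      then obtain x y where "e = {x, y}" by (auto simp: nsets_def card_2_iff)
      with e have "{x, y} \<in> P" by simp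
      then have v: "{0, y - x} \<in> P" using edge[OF P(1)] by blast
      have "y - x \<noteq> 0" using no_loop[OF P(1) v] by simp
      then obtain t where t: "t \<in> invs" "y - x \<in> fixed t" using fixed_exists by blast
      show "C \<in> blocks"
        using P(2) invs_neg[OF t(1)] t(1) unfolding cliques[OF P(1) v t] blocks_def by blast
    qed
    show "blocks \<subseteq> \<B>"
    proof
      fix C assume "C \<in> blocks"
      then obtain x t where t: "t \<in> invs" "C = (+) x ` fixed t" by (auto simp: blocks_def)
      obtain v where v: "v \<noteq> 0" "v \<in> fixed t" using fixed_nontrivial[OF t(1)] by blast
      obtain P where P: "P \<in> \<E>" "{0, v} \<in> P" using part_exists[OF v(1)] by blast
      then show "C \<in> \<B>" using cliques[OF P t(1) v(2)] t(2) assms(14) by auto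
    qed
  qed
  have "image g ` \<B> = \<B>" if g: "g \<in> G" for g
  proof -
    have bij: "bij g" using g G_Bij by (auto simp: Bij_def)
    \<comment> \<open>\<open>g\<close> permutes the factors and carries maximal cliques to maximal
      cliques; finiteness turns the inclusion into equality.\<close>
    have "image g ` \<B> \<subseteq> \<B>"
      using maximal_cliques_image[OF bij] Gperm[OF g] assms(14) by blast
    moreover have "inj_on (image g) \<B>"
      by (rule inj_onI) (use inj_image_eq_iff[OF bij_is_inj[OF bij]] in blast)
    ultimately show ?thesis by (intro endo_inj_surj) simp_all
  qed
  then have "subgroup G (design_Aut UNIV \<B>)" by (rule subgroup_design_Aut[OF sG]) simp_all
  then show ?thesis
    using card_block card_blocks blocks_partition blocks_two_design blocks_affine_plane
      blocks_nearfield_plane assms(8) unfolding \<B> by blast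
qed

end
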